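(* Let $X$ be a complex Hilbert space and let $A$ be the generator of a bounded $C_0$-semigroup $(T(t))_{t\ge0}$ on $X$. Suppose that $\sigma(A)\cap i\mathbb{R}=\{0\}$, that $\sup_{|s|\ge1}\|R(is,A)\|<\infty$ and that $M\colon[1,\infty)\to(0,\infty)$ is a continuous non-decreasing function of positive increase such that $\|R(is^{-1},A)\|\le M(|s|)$ for all $s\in\mathbb{R}$ with $|s|\ge1$. Then $$\|T(t)AR(1,A)\|=O\left(\frac{1}{M^{-1}(t)}\right),\quad t\to\infty.$$
   Context: A $C_0$-semigroup is bounded if $\sup_{t\ge0}\|T(t)\|<\infty$. For a closed operator $A$, $\sigma(A)$ is its spectrum and $R(z,A)=(zI-A)^{-1}$ for $z\notin\sigma(A)$. Given $a\ge0$, a measurable function $M\colon[a,\infty)\to(0,\infty)$ has positive increase if there exist constants $\alpha>0$, $c\in(0,1]$ and $s_0\ge a$ with $s_0>0$ such that $M(\lambda s)/M(s)\ge c\lambda^\alpha$ for all $\lambda\ge1$ and $s\ge s_0$ (in particular $M(s)\to\infty$ as $s\to\infty$). For a continuous non-decreasing function $M\colon[a,\infty)\to(0,\infty)$ with $M(s)\to\infty$ as $s\to\infty$, $M^{-1}$ denotes its right-continuous right-inverse $M^{-1}(t)=\sup\{r\ge a: M(r)\le t\}$, $t\ge M(a)$. $f(t)=O(g(t))$, $t\to\infty$, means there is a constant $C>0$ with $f(t)\le Cg(t)$ for all sufficiently large $t$. *)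

theory Defs
  imports "HOL-Analysis.Analysis" "HOL-Library.Landau_Symbols"
begin

text \<open>Complex vector spaces are real vector spaces with a compatible complex scalar
  multiplication.  A complex inner product (linear in the first argument) has as its real part
  the real inner product of the underlying class, so that the norm, the metric and the topology
  are those of \<^class>\<open>real_inner\<close>: \<open>norm x = sqrt (Re (cinner x x))\<close>.\<close>

class complex_vector = real_vector +
  fixes scaleC :: "complex \<Rightarrow> 'a \<Rightarrow> 'a" (infixr \<open>*\<^sub>C\<close> 75)
  assumes scaleC_add_right: "c *\<^sub>C (x + y) = c *\<^sub>C x + c *\<^sub>C y"
    and scaleC_add_left: "(c + d) *\<^sub>C x = c *\<^sub>C x + d *\<^sub>C x"
    and scaleC_scaleC: "c *\<^sub>C d *\<^sub>C x = (c * d) *\<^sub>C x"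
    and scaleC_of_real: "complex_of_real r *\<^sub>C x = r *\<^sub>R x"

class complex_inner = complex_vector + real_inner +
  fixes cinner :: "'a \<Rightarrow> 'a \<Rightarrow> complex"
  assumes cinner_commute: "cinner x y = cnj (cinner y x)"
    and cinner_add_left: "cinner (x + y) z = cinner x z + cinner y z"
    and cinner_scaleC_left: "cinner (c *\<^sub>C x) y = c * cinner x y"
    and Re_cinner: "Re (cinner x y) = inner x y"

class complex_hilbert_space = complex_inner + banach

instantiation complex :: complex_hilbert_space
begin

definition scaleC_complex :: "complex \<Rightarrow> complex \<Rightarrow> complex"
  where "scaleC_complex c x = c * x"

definition cinner_complex :: "complex \<Rightarrow> complex \<Rightarrow> complex"
  where "cinner_complex x y = x * cnj y"

instance
  by standard
    (auto simp: scaleC_complex_def cinner_complex_def inner_complex_def algebra_simps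
      scaleR_conv_of_real)

end

definition bounded_clinear :: "('a::complex_inner \<Rightarrow> 'b::complex_inner) \<Rightarrow> bool"
  where "bounded_clinear f \<longleftrightarrow> bounded_linear f \<and> (\<forall>c x. f (c *\<^sub>C x) = c *\<^sub>C f x)"

text \<open>A semigroup is indexed by \<^typ>\<open>real\<close>; only its values at \<open>t \<ge> 0\<close> matter.\<close>

definition C0_semigroup :: "(real \<Rightarrow> 'a \<Rightarrow> 'a::complex_inner) \<Rightarrow> bool"
  where "C0_semigroup T \<longleftrightarrow>
    (\<forall>t\<ge>0. bounded_clinear (T t)) \<and>
    (\<forall>x. T 0 x = x) \<and>
    (\<forall>s\<ge>0. \<forall>t\<ge>0. \<forall>x. T (s + t) x = T s (T t x)) \<and>
    (\<forall>x. ((\<lambda>t. T t x) \<longlongrightarrow> x) (at_right 0))"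

definition bounded_C0_semigroup :: "(real \<Rightarrow> 'a \<Rightarrow> 'a::complex_inner) \<Rightarrow> bool"
  where "bounded_C0_semigroup T \<longleftrightarrow>
    C0_semigroup T \<and> bdd_above ((\<lambda>t. onorm (T t)) ` {0..})"

text \<open>An unbounded operator is given by its domain \<open>D\<close> and a total function \<open>A\<close> whose values
  outside \<open>D\<close> are irrelevant.\<close>

definition is_generator ::
    "'a set \<Rightarrow> ('a \<Rightarrow> 'a) \<Rightarrow> (real \<Rightarrow> 'a \<Rightarrow> 'a::complex_inner) \<Rightarrow> bool"
  where "is_generator D A T \<longleftrightarrow>
    D = {x. \<exists>y. ((\<lambda>h. (T h x - x) /\<^sub>R h) \<longlongrightarrow> y) (at_right 0)} \<and>
    (\<forall>x\<in>D. ((\<lambda>h. (T h x - x) /\<^sub>R h) \<longlongrightarrow> A x) (at_right 0))"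

definition resolvent :: "'a set \<Rightarrow> ('a \<Rightarrow> 'a) \<Rightarrow> complex \<Rightarrow> 'a \<Rightarrow> 'a::complex_inner"
  where "resolvent D A z = inv_into D (\<lambda>x. z *\<^sub>C x - A x)"

definition spectrum :: "'a set \<Rightarrow> ('a \<Rightarrow> 'a::complex_inner) \<Rightarrow> complex set"
  where "spectrum D A =
    {z. \<not> (bij_betw (\<lambda>x. z *\<^sub>C x - A x) D UNIV \<and> bounded_clinear (resolvent D A z))}"

text \<open>A function on \<open>[a,\<infinity>)\<close> is represented by a total function whose values below \<open>a\<close> are
  irrelevant.\<close>

definition positive_increase :: "real \<Rightarrow> (real \<Rightarrow> real) \<Rightarrow> bool"
  where "positive_increase a M \<longleftrightarrow>
    0 \<le> a \<and> M \<in> borel_measurable (restrict_space borel {a..}) \<and> (\<forall>s\<ge>a. 0 < M s) \<and>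
    (\<exists>\<alpha>>0. \<exists>c\<in>{0<..1}. \<exists>s\<^sub>0\<ge>a. 0 < s\<^sub>0 \<and>
      (\<forall>\<mu>\<ge>1. \<forall>s\<ge>s\<^sub>0. M (\<mu> * s) / M s \<ge> c * \<mu> powr \<alpha>))"

text \<open>The value is meaningful only for \<open>t \<ge> M a\<close>, where the set is nonempty (and bounded if
  \<open>M\<close> tends to infinity).\<close>

definition right_inverse :: "real \<Rightarrow> (real \<Rightarrow> real) \<Rightarrow> real \<Rightarrow> real"
  where "right_inverse a M t = Sup {r. a \<le> r \<and> M r \<le> t}"

end

theory Submission
  imports Defs "HOL-Computational_Algebra.Polynomial"
begin

text \<open>
  For \<open>q = R(1,A) x\<close> both \<open>q\<close> and \<open>A q = q - x\<close> are bounded by a multiple of \<open>\<parallel>x\<parallel>\<close>, and the claim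
  is a decay estimate for \<open>T(t) A q\<close>.
  Write \<open>r = M\<^sup>-\<^sup>1(t)\<close>.  The proof estimates the orbit \<open>\<tau> \<mapsto> T(\<tau>) A q\<close> on \<open>[0,t]\<close> in mean square,
  frequency by frequency; boundedness of the semigroup gives
  \<open>\<parallel>T(t) A q\<parallel> \<le> K \<parallel>T(\<tau>) A q\<parallel>\<close> for \<open>\<tau> \<le> t\<close>, so a mean square bound of order \<open>1/r\<close> is a
  pointwise bound at time \<open>t\<close>.

  Rescale \<open>[0,t]\<close> to \<open>[0,1]\<close> and multiply the orbit by the polynomial
  \<open>p(\<theta>) = (\<theta> (1 - \<theta>))\<^sup>m\<close>, which makes it a periodic function.  Let \<open>c\<^sub>k(p; x)\<close> be the Fourier
  coefficients of \<open>\<theta> \<mapsto> p(\<theta>) T(t\<theta>) x\<close> and \<open>\<omega> = 2\<pi>k/t\<close>.  Integration by parts gives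
  \<open>c\<^sub>k(p; A q) = i\<omega> c\<^sub>k(p; q) - c\<^sub>k(p'; q) / t\<close>, and therefore
  \<open>c\<^sub>k(p; x) = R(i\<omega>,A) c\<^sub>k(p'; x) / t\<close> for \<open>\<omega> \<noteq> 0\<close>; the latter can be repeated \<open>m\<close> times.
  Three ranges of frequencies occur (lemma \<open>fourier_orbit_generator_bound\<close>).

  For \<open>\<bar>\<omega>\<bar> \<le> 1/r\<close> the first identity alone yields the factor \<open>1/r\<close>, as \<open>r \<le> t\<close>.

  For \<open>1/r < \<bar>\<omega>\<bar> \<le> 1\<close> both identities together leave the factor
  \<open>\<bar>\<omega>\<bar> (\<parallel>R(i\<omega>,A)\<parallel>/t)\<^sup>m\<close>, in which \<open>\<parallel>R(i\<omega>,A)\<parallel> \<le> M(1/\<bar>\<omega>\<bar>)\<close>.  Positive increase says that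
  \<open>M(1/\<bar>\<omega>\<bar>)/t\<close> is at most a constant times \<open>(r\<bar>\<omega>\<bar>)\<close> to the power \<open>-\<alpha>\<close>, so that for
  \<open>\<alpha>m \<ge> 1\<close> the product is again of order \<open>1/r\<close> (lemma \<open>positive_increase_absorbs_weight\<close>).

  For \<open>\<bar>\<omega>\<bar> > 1\<close> the resolvent is bounded and the factor is of order \<open>1/t\<^sup>m\<close>.

  The square sums of the coefficients on the right are controlled by Bessel's inequality, and
  Parseval's inequality converts the bound on \<open>c\<^sub>k(p; A q)\<close> into the mean square bound.  This last step
  is where the Hilbert space structure is essential.

  The inequality \<open>r \<le> t\<close> follows from \<open>M(s) \<ge> s\<close>, which holds because \<open>0\<close> is a spectral point:
  \<open>M(s) < s\<close> for some \<open>s \<ge> 1\<close> would put \<open>0\<close> into the resolvent set, by perturbation from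
  \<open>i/s\<close> (lemma \<open>resolvent_set_perturbation\<close>).
\<close>

section \<open>Complex scalars and the real inner product\<close>

lemma inner_scaleC_left:
  fixes x y :: "'a::complex_inner"
  shows "inner (c *\<^sub>C x) y = inner x (cnj c *\<^sub>C y)"
proof -
  have "cinner x (cnj c *\<^sub>C y) = c * cinner x y"
    by (metis cinner_commute cinner_scaleC_left complex_cnj_cnj complex_cnj_mult)
  then show ?thesis
    by (metis Re_cinner cinner_scaleC_left)
qed

lemma scaleC_one [simp]: "1 *\<^sub>C x = (x::'a::complex_vector)"
  using scaleC_of_real[of 1 x] by simp

lemma scaleC_zero [simp]: "0 *\<^sub>C x = (0::'a::complex_vector)"
  using scaleC_of_real[of 0 x] by simp

lemma norm_scaleC [simp]: "norm (c *\<^sub>C x) = cmod c * norm (x::'a::complex_inner)"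
proof -
  have "inner (c *\<^sub>C x) (c *\<^sub>C x) = (cmod c)\<^sup>2 * inner x x"
    unfolding inner_scaleC_left scaleC_scaleC mult.commute[of "cnj c"] complex_norm_square[symmetric]
    by (metis inner_scaleR_right of_real_power scaleC_of_real)
  then show ?thesis
    by (simp add: norm_eq_sqrt_inner real_sqrt_mult)
qed

lemma bounded_bilinear_scaleC:
  "bounded_bilinear (scaleC :: complex \<Rightarrow> 'a \<Rightarrow> 'a::complex_inner)"
proof
  fix r :: real and c :: complex and x :: 'a
  have "(r *\<^sub>R c) *\<^sub>C x = complex_of_real r *\<^sub>C c *\<^sub>C x"
    by (simp add: scaleC_scaleC scaleR_conv_of_real)
  then show "(r *\<^sub>R c) *\<^sub>C x = r *\<^sub>R c *\<^sub>C x"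
    by (simp add: scaleC_of_real)
  have "c *\<^sub>C (r *\<^sub>R x) = (c * complex_of_real r) *\<^sub>C x"
    by (metis scaleC_of_real scaleC_scaleC)
  also have "\<dots> = complex_of_real r *\<^sub>C c *\<^sub>C x"
    by (simp add: scaleC_scaleC mult.commute)
  finally show "c *\<^sub>C (r *\<^sub>R x) = r *\<^sub>R c *\<^sub>C x"
    by (simp add: scaleC_of_real)
next
  show "\<exists>K. \<forall>a b. norm (a *\<^sub>C b) \<le> norm a * norm (b::'a) * K"
    by (rule exI[of _ 1]) simp
qed (simp_all add: scaleC_add_left scaleC_add_right)

lemmas continuous_on_scaleC [continuous_intros] =
  bounded_bilinear.continuous_on[OF bounded_bilinear_scaleC]
lemmas bounded_linear_scaleC_right = bounded_bilinear.bounded_linear_right[OF bounded_bilinear_scaleC]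
lemmas bounded_linear_scaleC_left = bounded_bilinear.bounded_linear_left[OF bounded_bilinear_scaleC]
lemmas scaleC_diff_right = bounded_bilinear.diff_right[OF bounded_bilinear_scaleC]
lemmas scaleC_sum_left = bounded_bilinear.sum_left[OF bounded_bilinear_scaleC]
lemmas scaleC_scaleR_right = bounded_bilinear.scaleR_right[OF bounded_bilinear_scaleC]

section \<open>Fourier series of Hilbert space valued functions\<close>

definition wave :: "int \<Rightarrow> real \<Rightarrow> complex"
  where "wave k \<theta> = cis (2 * pi * of_int k * \<theta>)"

lemma continuous_on_wave [continuous_intros]:
  "continuous_on S f \<Longrightarrow> continuous_on S (\<lambda>x. wave k (f x))"
  unfolding wave_def cis_conv_exp by (intro continuous_intros)

lemma wave_mult: "wave j \<theta> * wave k \<theta> = wave (j + k) \<theta>"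
  by (simp add: wave_def cis_mult algebra_simps)

lemma wave_0 [simp]: "wave 0 \<theta> = 1"
  and wave_at_0 [simp]: "wave k 0 = 1"
  and norm_wave [simp]: "cmod (wave k \<theta>) = 1"
  by (simp_all add: wave_def)

lemma wave_at_1 [simp]: "wave k 1 = 1"
  unfolding wave_def by (metis cis_multiple_2pi Ints_of_int mult.right_neutral)

lemma cnj_wave: "cnj (wave k \<theta>) = wave (- k) \<theta>"
  by (simp add: wave_def cis_cnj)

lemma wave_has_vector_derivative:
  "(wave k has_vector_derivative 2 * pi * \<i> * of_int k * wave k \<theta>) (at \<theta> within S)"
  unfolding wave_def cis_conv_exp
  by (rule has_vector_derivative_eq_rhs)
     (auto intro!: derivative_eq_intros has_vector_derivative_real_field
        exp_scaleR_has_vector_derivative_right simp: algebra_simps)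

lemma integral_wave: "integral {0..1} (wave k) = (if k = 0 then 1 else 0)"
proof (cases "k = 0")
  case True
  then have "wave k = (\<lambda>_. 1)" by (simp add: fun_eq_iff)
  with True show ?thesis by simp
next
  case False
  have "((\<lambda>\<theta>. 2 * pi * \<i> * of_int k * wave k \<theta>) has_integral wave k 1 - wave k 0) {0..1}"
    by (intro fundamental_theorem_of_calculus wave_has_vector_derivative) simp
  then have "integral {0..1} (\<lambda>\<theta>. 2 * pi * \<i> * of_int k * wave k \<theta>) = wave k 1 - wave k 0"
    by (rule integral_unique)
  then have "(2 * pi * \<i> * of_int k) * integral {0..1} (wave k) = 0"
    by (simp only: integral_mult_right wave_at_0 wave_at_1 diff_self)
  with False show ?thesis by simp
qed

definition fourier :: "(real \<Rightarrow> 'a::complex_inner) \<Rightarrow> int \<Rightarrow> 'a"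
  where "fourier v k = integral {0..1} (\<lambda>\<theta>. wave (- k) \<theta> *\<^sub>C v \<theta>)"

lemma integral_inner_wave:
  fixes v :: "real \<Rightarrow> 'a::complex_hilbert_space"
  assumes "continuous_on {0..1} v"
  shows "integral {0..1} (\<lambda>\<theta>. inner (v \<theta>) (wave k \<theta> *\<^sub>C c)) = inner (fourier v k) c"
proof -
  have int: "(\<lambda>\<theta>. wave (- k) \<theta> *\<^sub>C v \<theta>) integrable_on {0..1}"
    by (intro integrable_continuous_real continuous_intros assms)
  have "integral {0..1} (\<lambda>\<theta>. inner (wave (- k) \<theta> *\<^sub>C v \<theta>) c) = inner (fourier v k) c"
    unfolding fourier_def
    using integral_linear[OF int bounded_linear_inner_left[of c]] by (simp add: o_def)
  then show ?thesis
    by (simp add: inner_scaleC_left cnj_wave)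
qed

text \<open>
  The mean square distance between \<open>v\<close> and its partial Fourier sum over \<open>F\<close> is nonnegative and equals
  the mean square of \<open>v\<close> minus the sum on the left.
\<close>

lemma bessel:
  fixes v :: "real \<Rightarrow> 'a::complex_hilbert_space"
  assumes v: "continuous_on {0..1} v" and bound: "\<And>\<theta>. \<theta> \<in> {0..1} \<Longrightarrow> norm (v \<theta>) \<le> B"
    and F: "finite F"
  shows "(\<Sum>k\<in>F. (norm (fourier v k))\<^sup>2) \<le> B\<^sup>2"
proof -
  define c where "c = fourier v"
  define p where "p = (\<lambda>\<theta>. \<Sum>k\<in>F. wave k \<theta> *\<^sub>C c k)"
  have pc: "continuous_on {0..1} p"
    unfolding p_def by (intro continuous_intros)
  have vp: "integral {0..1} (\<lambda>\<theta>. inner (w \<theta>) (p \<theta>)) = (\<Sum>k\<in>F. inner (fourier w k) (c k))"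
    if "continuous_on {0..1} w" for w :: "real \<Rightarrow> 'a"
  proof -
    have "integral {0..1} (\<lambda>\<theta>. inner (w \<theta>) (p \<theta>))
        = (\<Sum>k\<in>F. integral {0..1} (\<lambda>\<theta>. inner (w \<theta>) (wave k \<theta> *\<^sub>C c k)))"
      unfolding p_def inner_sum_right
      by (intro integral_sum F integrable_continuous_real continuous_intros that)
    then show ?thesis using that by (simp add: integral_inner_wave)
  qed
  have fp: "fourier p k = c k" if "k \<in> F" for k
  proof -
    have "fourier p k = integral {0..1} (\<lambda>\<theta>. \<Sum>j\<in>F. wave (j - k) \<theta> *\<^sub>C c j)"
      unfolding fourier_def p_def
      by (simp add: bounded_bilinear.sum_right[OF bounded_bilinear_scaleC] scaleC_scaleC wave_mult)
    also have "\<dots> = (\<Sum>j\<in>F. integral {0..1} (\<lambda>\<theta>. wave (j - k) \<theta> *\<^sub>C c j))"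
      by (intro integral_sum F integrable_continuous_real continuous_intros)
    also have "\<dots> = (\<Sum>j\<in>F. (if j = k then c j else 0))"
    proof (rule sum.cong)
      fix j
      have "wave (j - k) integrable_on {0..1}"
        by (intro integrable_continuous_real continuous_intros)
      from integral_linear[OF this bounded_linear_scaleC_left[of "c j"]]
      show "integral {0..1} (\<lambda>\<theta>. wave (j - k) \<theta> *\<^sub>C c j) = (if j = k then c j else 0)"
        by (simp add: o_def integral_wave)
    qed simp
    finally show ?thesis using F that by (simp add: sum.delta)
  qed
  have "0 \<le> integral {0..1} (\<lambda>\<theta>. (norm (v \<theta> - p \<theta>))\<^sup>2)"
    by (intro integral_nonneg integrable_continuous_real continuous_intros v pc) simp
  also have "\<dots> = integral {0..1} (\<lambda>\<theta>. (norm (v \<theta>))\<^sup>2 - 2 * inner (v \<theta>) (p \<theta>) + inner (p \<theta>) (p \<theta>))"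
    by (simp add: power2_norm_eq_inner inner_diff_left inner_diff_right inner_commute algebra_simps)
  also have "\<dots> = integral {0..1} (\<lambda>\<theta>. (norm (v \<theta>))\<^sup>2)
      - 2 * integral {0..1} (\<lambda>\<theta>. inner (v \<theta>) (p \<theta>)) + integral {0..1} (\<lambda>\<theta>. inner (p \<theta>) (p \<theta>))"
    by (subst integral_add integral_diff;
        (intro integrable_continuous_real continuous_intros v pc)?)+ simp
  also have "\<dots> = integral {0..1} (\<lambda>\<theta>. (norm (v \<theta>))\<^sup>2) - (\<Sum>k\<in>F. (norm (c k))\<^sup>2)"
    unfolding vp[OF v] vp[OF pc]
    by (simp add: fp power2_norm_eq_inner c_def sum_distrib_left)
  finally have "(\<Sum>k\<in>F. (norm (c k))\<^sup>2) \<le> integral {0..1} (\<lambda>\<theta>. (norm (v \<theta>))\<^sup>2)" by simp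
  also have "\<dots> \<le> integral {0..1} (\<lambda>\<theta>::real. B\<^sup>2)"
    using bound
    by (intro integral_le integrable_continuous_real continuous_intros v) (auto intro: power_mono)
  finally show ?thesis by (simp add: c_def)
qed

text \<open>
  The Fejer kernel, written as a square so that its positivity and its concentration near the
  integers are visible.
\<close>

definition fejer :: "nat \<Rightarrow> real \<Rightarrow> real"
  where "fejer N x = (cmod (\<Sum>j<N. wave (int j) x))\<^sup>2 / N"

lemma fejer_eq_sum:
  "complex_of_real (fejer N x) = (\<Sum>j<N. \<Sum>l<N. wave (int j - int l) x) / N"
proof -
  have "complex_of_real ((cmod (\<Sum>j<N. wave (int j) x))\<^sup>2)
      = (\<Sum>j<N. wave (int j) x) * (\<Sum>l<N. wave (- int l) x)"
    by (simp only: complex_norm_square cnj_wave cnj_sum)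
  then show ?thesis
    by (simp add: fejer_def sum_product wave_mult)
qed

text \<open>
  A geometric sum: multiplying the kernel by the squared chord length between \<open>x\<close> and \<open>0\<close> on
  the circle cancels the singularity.  This replaces any splitting of the circle into a neighbourhood
  of \<open>0\<close> and its complement.
\<close>

lemma fejer_concentrated: "fejer N x * (cmod (wave 1 x - 1))\<^sup>2 \<le> 4 / N"
proof -
  have eq: "wave (int j) x = wave 1 x ^ j" for j
    unfolding wave_def by (simp add: Complex.DeMoivre mult_ac)
  have "(\<Sum>j<N. wave (int j) x) * (wave 1 x - 1) = wave 1 x ^ N - 1"
    unfolding eq using power_diff_1_eq[of "wave 1 x" N] by (simp add: mult.commute)
  then have "fejer N x * (cmod (wave 1 x - 1))\<^sup>2 = (cmod (wave 1 x ^ N - 1))\<^sup>2 / N"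
    by (simp add: fejer_def flip: power_mult_distrib norm_mult)
  moreover have "cmod (wave 1 x ^ N - 1) \<le> 2"
    using norm_triangle_ineq4[of "wave 1 x ^ N" 1] by (simp add: norm_power)
  then have "(cmod (wave 1 x ^ N - 1))\<^sup>2 \<le> 2\<^sup>2"
    by (intro power_mono) auto
  ultimately show ?thesis
    by (simp add: divide_right_mono)
qed

lemma continuous_on_fejer [continuous_intros]:
  "continuous_on S f \<Longrightarrow> continuous_on S (\<lambda>x. fejer N (f x))"
  unfolding fejer_def divide_inverse by (intro continuous_intros)

lemma wave_diff: "wave k (x - y) = wave k x * wave (- k) y"
  by (simp add: wave_def cis_mult algebra_simps)

lemma integral_fejer_scaleR:
  fixes u :: "real \<Rightarrow> 'a::complex_hilbert_space"
  assumes u: "continuous_on {0..1} u"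
  shows "integral {0..1} (\<lambda>s. fejer N (\<theta> - s) *\<^sub>R u s)
    = (1 / N) *\<^sub>R (\<Sum>j<N. \<Sum>l<N. wave (int j - int l) \<theta> *\<^sub>C fourier u (int j - int l))"
proof -
  have "fejer N (\<theta> - s) *\<^sub>R u s
      = (1 / N) *\<^sub>R (\<Sum>j<N. \<Sum>l<N. wave (int j - int l) \<theta> *\<^sub>C wave (- (int j - int l)) s *\<^sub>C u s)" for s
  proof -
    have "fejer N (\<theta> - s) *\<^sub>R u s = complex_of_real (fejer N (\<theta> - s)) *\<^sub>C u s"
      by (simp add: scaleC_of_real)
    also have "\<dots> = complex_of_real (1 / N) *\<^sub>C (\<Sum>j<N. \<Sum>l<N. wave (int j - int l) (\<theta> - s)) *\<^sub>C u s"
      by (simp add: fejer_eq_sum scaleC_scaleC)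
    also have "\<dots> = (1 / N) *\<^sub>R (\<Sum>j<N. \<Sum>l<N. wave (int j - int l) (\<theta> - s)) *\<^sub>C u s"
      by (simp only: scaleC_of_real)
    finally show ?thesis
      by (simp add: scaleC_sum_left wave_diff scaleC_scaleC)
  qed
  moreover have "integral {0..1} (\<lambda>s. \<Sum>j<N. \<Sum>l<N. wave (int j - int l) \<theta> *\<^sub>C wave (- (int j - int l)) s *\<^sub>C u s)
     = (\<Sum>j<N. \<Sum>l<N. wave (int j - int l) \<theta> *\<^sub>C fourier u (int j - int l))"
  proof -
    have int: "(\<lambda>s. wave k s *\<^sub>C u s) integrable_on {0..1}" for k
      by (intro integrable_continuous_real continuous_intros u)
    have "integral {0..1} (\<lambda>s. c *\<^sub>C wave (- k) s *\<^sub>C u s) = c *\<^sub>C fourier u k" for c k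
      unfolding fourier_def
      using integral_linear[OF int bounded_linear_scaleC_right] by (simp add: o_def)
    moreover have "integral {0..1} (\<lambda>s. \<Sum>j<N. \<Sum>l<N. wave (int j - int l) \<theta> *\<^sub>C wave (- (int j - int l)) s *\<^sub>C u s)
     = (\<Sum>j<N. \<Sum>l<N. integral {0..1} (\<lambda>s. wave (int j - int l) \<theta> *\<^sub>C wave (- (int j - int l)) s *\<^sub>C u s))"
      by (subst integral_sum,
          (intro finite_lessThan integrable_continuous_real continuous_intros u)+,
          subst integral_sum,
          (intro finite_lessThan integrable_continuous_real continuous_intros u)+, rule refl)
    ultimately show ?thesis by (simp only:)
  qed
  ultimately show ?thesis by simp
qed

lemma integral_fejer:
  assumes "N > 0"
  shows "integral {0..1} (\<lambda>s. fejer N (\<theta> - s)) = 1"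
proof -
  have four: "fourier (\<lambda>_. 1::complex) k = (if k = 0 then 1 else 0)" for k
    using integral_wave[of "-k"] by (simp add: fourier_def scaleC_complex_def)
  have "integral {0..1} (\<lambda>s. fejer N (\<theta> - s) *\<^sub>R (1::complex)) =
    (1 / N) *\<^sub>R (\<Sum>j<N. \<Sum>l<N. (if j = l then 1 else 0))"
    unfolding integral_fejer_scaleR[OF continuous_on_const] four
    by (intro arg_cong[where f = "\<lambda>z. (1 / N) *\<^sub>R z"] sum.cong refl)
       (auto simp: scaleC_complex_def)
  also have "\<dots> = 1"
    using assms by (simp add: sum.delta scaleR_conv_of_real)
  finally have "complex_of_real (integral {0..1} (\<lambda>s. fejer N (\<theta> - s))) = 1"
    using integral_linear[OF integrable_continuous_real bounded_linear_of_real[where 'a=complex],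
        of 0 1 "\<lambda>s. fejer N (\<theta> - s)"]
    by (simp add: o_def scaleR_conv_of_real continuous_intros)
  then show ?thesis by simp
qed

lemma wave_1_eq_imp:
  assumes "x \<in> {0..1}" "y \<in> {0..1}" "wave 1 x = wave 1 y"
  shows "x = y \<or> {x, y} = {0, 1}"
proof -
  have "cis (2 * pi * (x - y)) = 1"
    using assms(3) unfolding wave_def
    by (simp add: right_diff_distrib flip: cis_divide)
  then obtain n :: int where "2 * pi * (x - y) = of_int n * 2 * pi"
    using cos_one_2pi_int[of "2 * pi * (x - y)"] by (auto simp: complex_eq_iff)
  then have n: "x - y = of_int n" by simp
  with assms have "\<bar>of_int n\<bar> \<le> (1::real)" by auto
  then have "n = 0 \<or> n = 1 \<or> n = -1" by linarith
  with n assms show ?thesis by auto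
qed

text \<open>
  Uniform continuity on the circle in the form that matches \<open>fejer_concentrated\<close>: the pairs of
  points at which \<open>u\<close> differs by at least \<open>\<epsilon>\<close> form a compact set.  The chord length vanishes nowhere on
  it, as \<open>u 0 = u 1\<close>, and so has a positive minimum there.
\<close>

lemma periodic_modulus_of_continuity:
  fixes u :: "real \<Rightarrow> 'a::complex_hilbert_space"
  assumes u: "continuous_on {0..1} u" and periodic: "u 0 = u 1" and "\<epsilon> > 0"
  obtains C where "C \<ge> 0" "\<And>x y. x \<in> {0..1} \<Longrightarrow> y \<in> {0..1} \<Longrightarrow>
    norm (u x - u y) \<le> \<epsilon> + C * (cmod (wave 1 (x - y) - 1))\<^sup>2"
proof -
  define g where "g = (\<lambda>z. norm (u (fst z) - u (snd z)))"
  define f where "f = (\<lambda>z. (cmod (wave 1 (fst z - snd z) - 1))\<^sup>2)"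
  let ?Q = "{0..1::real} \<times> {0..1::real}"
  have "continuous_on ?Q (\<lambda>z. u (fst z))" "continuous_on ?Q (\<lambda>z. u (snd z))"
    by (auto intro!: continuous_on_compose2[OF u] continuous_intros)
  then have g: "continuous_on ?Q g"
    unfolding g_def by (intro continuous_intros)
  have f: "continuous_on S f" for S
    unfolding f_def by (intro continuous_intros)
  have Q: "compact ?Q" by (intro compact_Times compact_Icc)
  define E where "E = {z \<in> ?Q. \<epsilon> \<le> g z}"
  have "closed E"
    unfolding E_def using continuous_closed_preimage[OF g compact_imp_closed[OF Q] closed_atLeast[of \<epsilon>]]
    by (simp add: vimage_def Int_def)
  then have E: "compact E"
    unfolding E_def using compact_Int_closed[OF Q] by (simp add: Int_def E_def conj_ac)
       (metis (mono_tags, lifting) Collect_cong mem_Collect_eq)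
  show ?thesis
  proof (cases "E = {}")
    case True
    then have "norm (u x - u y) \<le> \<epsilon> + 0 * (cmod (wave 1 (x - y) - 1))\<^sup>2"
      if "x \<in> {0..1}" "y \<in> {0..1}" for x y
      using that by (force simp: E_def g_def)
    then show ?thesis using that[of 0] by blast
  next
    case False
    obtain z0 where z0: "z0 \<in> E" "\<And>z. z \<in> E \<Longrightarrow> f z0 \<le> f z"
      using continuous_attains_inf[OF E False f] by blast
    have "?Q \<noteq> {}" by auto
    from continuous_attains_sup[OF Q this g] obtain B where B: "\<And>z. z \<in> ?Q \<Longrightarrow> g z \<le> B" by blast
    have "f z0 \<noteq> 0"
    proof
      assume "f z0 = 0"
      then have "wave 1 (fst z0 - snd z0) = 1" by (simp add: f_def)
      then have "wave 1 (fst z0) * wave (-1) (snd z0) = 1" by (simp add: wave_diff)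
      then have "wave 1 (fst z0) = wave 1 (snd z0)"
        by (metis add.left_inverse mult.assoc mult.left_neutral mult.right_neutral wave_0 wave_mult)
      with z0(1) have "fst z0 = snd z0 \<or> {fst z0, snd z0} = {0, 1}"
        by (intro wave_1_eq_imp) (auto simp: E_def)
      with periodic have "g z0 = 0" by (auto simp: g_def doubleton_eq_iff)
      with z0(1) \<open>\<epsilon> > 0\<close> show False by (simp add: E_def)
    qed
    then have pos: "f z0 > 0" by (simp add: f_def)
    have "0 \<le> g z0" by (simp add: g_def)
    then have B0: "0 \<le> B" using B[of z0] z0(1) by (simp add: E_def)
    have "g z \<le> \<epsilon> + (B / f z0) * f z" if z: "z \<in> ?Q" for z
    proof (cases "z \<in> E")
      case True
      have "g z \<le> (B / f z0) * f z0" using B[OF z] pos by simp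
      also have "\<dots> \<le> (B / f z0) * f z"
        using z0(2)[OF True] B0 pos by (intro mult_left_mono) auto
      finally show ?thesis using \<open>\<epsilon> > 0\<close> by simp
    next
      case False
      then have "g z \<le> \<epsilon>" using z by (auto simp: E_def)
      moreover have "0 \<le> (B / f z0) * f z" using B0 pos by (simp add: f_def)
      ultimately show ?thesis by simp
    qed
    from this[of "(_, _)"] show ?thesis
      using that[of "B / f z0"] B0 pos by (simp add: f_def g_def)
  qed
qed

text \<open>
  The Fejer means of \<open>u\<close> converge uniformly to \<open>u\<close>, and the inner product of \<open>u\<close> with one of
  its Fejer means is an average of partial sums of the squared coefficients.
\<close>

lemma parseval_le:
  fixes u :: "real \<Rightarrow> 'a::complex_hilbert_space"
  assumes u: "continuous_on {0..1} u" and periodic: "u 0 = u 1"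
    and S: "\<And>F. finite F \<Longrightarrow> (\<Sum>k\<in>F. (norm (fourier u k))\<^sup>2) \<le> S"
  shows "integral {0..1} (\<lambda>\<theta>. (norm (u \<theta>))\<^sup>2) \<le> S"
proof (rule field_le_epsilon)
  fix e :: real assume "e > 0"
  obtain B where B: "B > 0" "\<And>\<theta>. \<theta> \<in> {0..1} \<Longrightarrow> norm (u \<theta>) \<le> B"
    using compact_imp_bounded[OF compact_continuous_image[OF u compact_Icc]]
    by (auto simp: bounded_pos)
  \<comment> \<open>The final error is \<open>B\<close> times the uniform distance \<open>2\<epsilon>\<close> from \<open>u\<close> to its Fejer mean.\<close>
  define \<epsilon> where "\<epsilon> = e / (2 * B)"
  have \<epsilon>: "\<epsilon> > 0" using B \<open>e > 0\<close> by (simp add: \<epsilon>_def)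
  obtain C where C: "C \<ge> 0" "\<And>x y. x \<in> {0..1} \<Longrightarrow> y \<in> {0..1} \<Longrightarrow>
    norm (u x - u y) \<le> \<epsilon> + C * (cmod (wave 1 (x - y) - 1))\<^sup>2"
    using periodic_modulus_of_continuity[OF u periodic \<epsilon>] by blast
  obtain N :: nat where N: "4 * C / \<epsilon> < N" using reals_Archimedean2 by blast
  then have N0: "N > 0" using C \<epsilon> by (cases N) (auto simp: not_less divide_less_eq)
  have CN: "4 * C / N \<le> \<epsilon>" using N N0 \<epsilon> by (simp add: field_simps)
  define \<sigma> where "\<sigma> = (\<lambda>\<theta>. (1 / N) *\<^sub>R (\<Sum>j<N. \<Sum>l<N. wave (int j - int l) \<theta> *\<^sub>C fourier u (int j - int l)))"
  have \<sigma>c: "continuous_on {0..1} \<sigma>" unfolding \<sigma>_def by (intro continuous_intros)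
  have approx: "norm (u \<theta> - \<sigma> \<theta>) \<le> 2 * \<epsilon>" if \<theta>: "\<theta> \<in> {0..1}" for \<theta>
  proof -
    have fint: "(\<lambda>s. fejer N (\<theta> - s)) integrable_on {0..1}"
      by (intro integrable_continuous_real continuous_intros)
    have i1: "integral {0..1} (\<lambda>s. fejer N (\<theta> - s) *\<^sub>R u \<theta>) = u \<theta>"
      using integral_linear[OF fint bounded_linear_scaleR_left] by (simp add: o_def integral_fejer[OF N0])
    have "u \<theta> - \<sigma> \<theta> = integral {0..1} (\<lambda>s. fejer N (\<theta> - s) *\<^sub>R u \<theta> - fejer N (\<theta> - s) *\<^sub>R u s)"
      by (subst integral_diff)
         (auto simp: i1 \<sigma>_def integral_fejer_scaleR[OF u]
           intro!: integrable_continuous_real continuous_intros u)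
    also have "norm \<dots> \<le> integral {0..1} (\<lambda>s. \<epsilon> * fejer N (\<theta> - s) + 4 * C / N)"
    proof (rule integral_norm_bound_integral)
      fix s :: real assume s: "s \<in> {0..1}"
      have "fejer N (\<theta> - s) *\<^sub>R u \<theta> - fejer N (\<theta> - s) *\<^sub>R u s = fejer N (\<theta> - s) *\<^sub>R (u \<theta> - u s)"
        by (simp add: scaleR_diff_right)
      moreover have f0: "0 \<le> fejer N (\<theta> - s)" by (simp add: fejer_def)
      ultimately have "norm (fejer N (\<theta> - s) *\<^sub>R u \<theta> - fejer N (\<theta> - s) *\<^sub>R u s)
          = fejer N (\<theta> - s) * norm (u \<theta> - u s)" by simp
      also have "\<dots> \<le> fejer N (\<theta> - s) * (\<epsilon> + C * (cmod (wave 1 (\<theta> - s) - 1))\<^sup>2)"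
        by (intro mult_left_mono C \<theta> s f0)
      also have "\<dots> = \<epsilon> * fejer N (\<theta> - s) + C * (fejer N (\<theta> - s) * (cmod (wave 1 (\<theta> - s) - 1))\<^sup>2)"
        by (simp add: algebra_simps)
      also have "\<dots> \<le> \<epsilon> * fejer N (\<theta> - s) + C * (4 / N)"
        by (intro add_left_mono mult_left_mono fejer_concentrated C(1))
      finally show "norm (fejer N (\<theta> - s) *\<^sub>R u \<theta> - fejer N (\<theta> - s) *\<^sub>R u s)
          \<le> \<epsilon> * fejer N (\<theta> - s) + 4 * C / N" by (simp add: mult.commute)
    qed (intro integrable_continuous_real continuous_intros u)+
    also have "\<dots> = \<epsilon> + 4 * C / N"
    proof -
      have "integral {0..1} (\<lambda>s. \<epsilon> * fejer N (\<theta> - s) + 4 * C / N)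
          = integral {0..1} (\<lambda>s. \<epsilon> * fejer N (\<theta> - s)) + integral {0..1} (\<lambda>s::real. 4 * C / N)"
        by (intro integral_add integrable_continuous_real continuous_intros)
      then show ?thesis by (simp add: integral_fejer[OF N0])
    qed
    finally show ?thesis using CN by simp
  qed
  have "integral {0..1} (\<lambda>\<theta>. (norm (u \<theta>))\<^sup>2)
      \<le> integral {0..1} (\<lambda>\<theta>. inner (u \<theta>) (\<sigma> \<theta>) + e)"
  proof (rule integral_le)
    fix \<theta> :: real assume \<theta>: "\<theta> \<in> {0..1}"
    have "(norm (u \<theta>))\<^sup>2 = inner (u \<theta>) (\<sigma> \<theta>) + inner (u \<theta>) (u \<theta> - \<sigma> \<theta>)"
      by (simp add: inner_diff_right power2_norm_eq_inner)
    moreover have "inner (u \<theta>) (u \<theta> - \<sigma> \<theta>) \<le> norm (u \<theta>) * norm (u \<theta> - \<sigma> \<theta>)"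
      by (rule norm_cauchy_schwarz)
    moreover have "\<dots> \<le> B * (2 * \<epsilon>)"
      by (intro mult_mono B approx \<theta>) (use B in auto)
    moreover have "B * (2 * \<epsilon>) = e" using B by (simp add: \<epsilon>_def)
    ultimately show "(norm (u \<theta>))\<^sup>2 \<le> inner (u \<theta>) (\<sigma> \<theta>) + e" by linarith
  qed (intro integrable_continuous_real continuous_intros u \<sigma>c)+
  also have "\<dots> = integral {0..1} (\<lambda>\<theta>. inner (u \<theta>) (\<sigma> \<theta>)) + e"
    by (subst integral_add) (auto intro!: integrable_continuous_real continuous_intros u \<sigma>c)
  also have "integral {0..1} (\<lambda>\<theta>. inner (u \<theta>) (\<sigma> \<theta>))
      = (1 / N) * (\<Sum>j<N. \<Sum>l<N. (norm (fourier u (int j - int l)))\<^sup>2)"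
  proof -
    have "integral {0..1} (\<lambda>\<theta>. \<Sum>j<N. \<Sum>l<N. inner (u \<theta>) (wave (int j - int l) \<theta> *\<^sub>C fourier u (int j - int l)))
       = (\<Sum>j<N. \<Sum>l<N. integral {0..1} (\<lambda>\<theta>. inner (u \<theta>) (wave (int j - int l) \<theta> *\<^sub>C fourier u (int j - int l))))"
      by (subst integral_sum,
          (intro finite_lessThan integrable_continuous_real continuous_intros u)+,
          subst integral_sum,
          (intro finite_lessThan integrable_continuous_real continuous_intros u)+, rule refl)
    then show ?thesis
      unfolding \<sigma>_def inner_scaleR_right inner_sum_right
      by (simp add: integral_inner_wave[OF u] power2_norm_eq_inner)
  qed
  also have "\<dots> \<le> (1 / N) * (\<Sum>j<N. S)"
  proof (intro mult_left_mono sum_mono)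
    fix j
    have "(\<Sum>l<N. (norm (fourier u (int j - int l)))\<^sup>2)
        = (\<Sum>k\<in>(\<lambda>l. int j - int l) ` {..<N}. (norm (fourier u k))\<^sup>2)"
      by (subst sum.reindex) (auto simp: inj_on_def)
    also have "\<dots> \<le> S" by (rule S) simp
    finally show "(\<Sum>l<N. (norm (fourier u (int j - int l)))\<^sup>2) \<le> S" .
  qed simp
  also have "(1 / N) * (\<Sum>j<N. S) = S" using N0 by simp
  finally show "integral {0..1} (\<lambda>\<theta>. (norm (u \<theta>))\<^sup>2) \<le> S + e" by simp
qed

text \<open>
  The only way in which Fourier series enter the decay estimate: a bound between coefficients,
  uniform in the frequency, becomes a bound between functions.
\<close>

lemma parseval_domination:
  fixes u :: "real \<Rightarrow> 'a::complex_hilbert_space" and E B :: real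
    and vs :: "(real \<Rightarrow> 'a) list"
  assumes u: "continuous_on {0..1} u" "u 0 = u 1"
    and v: "\<And>v. v \<in> set vs \<Longrightarrow> continuous_on {0..1} v"
    and B: "\<And>v \<theta>. v \<in> set vs \<Longrightarrow> \<theta> \<in> {0..1} \<Longrightarrow> norm (v \<theta>) \<le> B"
    and E: "0 \<le> E"
    and dom: "\<And>k. norm (fourier u k) \<le> E * (\<Sum>v\<leftarrow>vs. norm (fourier v k))"
  shows "integral {0..1} (\<lambda>\<theta>. (norm (u \<theta>))\<^sup>2) \<le> (length vs * E * B)\<^sup>2"
proof (rule parseval_le[OF u])
  fix F :: "int set" assume F: "finite F"
  let ?n = "length vs"
  have "(norm (fourier u k))\<^sup>2 \<le> E\<^sup>2 * (?n * (\<Sum>i<?n. (norm (fourier (vs ! i) k))\<^sup>2))" for k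
  proof -
    have "(norm (fourier u k))\<^sup>2 \<le> (E * (\<Sum>i<?n. norm (fourier (vs ! i) k)))\<^sup>2"
      using dom[of k] by (intro power_mono) (auto simp: sum_list_sum_nth lessThan_atLeast0)
    also have "\<dots> \<le> E\<^sup>2 * (?n * (\<Sum>i<?n. (norm (fourier (vs ! i) k))\<^sup>2))"
      unfolding power_mult_distrib
      using sum_squared_le_sum_of_squares[of "\<lambda>i. norm (fourier (vs ! i) k)" "{..<?n}"]
      by (intro mult_left_mono) (auto simp: mult.commute)
    finally show ?thesis .
  qed
  then have "(\<Sum>k\<in>F. (norm (fourier u k))\<^sup>2)
      \<le> (\<Sum>k\<in>F. E\<^sup>2 * (?n * (\<Sum>i<?n. (norm (fourier (vs ! i) k))\<^sup>2)))"
    by (rule sum_mono)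
  also have "\<dots> = E\<^sup>2 * (?n * (\<Sum>i<?n. \<Sum>k\<in>F. (norm (fourier (vs ! i) k))\<^sup>2))"
    unfolding sum_distrib_left[symmetric] by (simp only: sum.swap[of _ F])
  also have "\<dots> \<le> E\<^sup>2 * (?n * (\<Sum>i<?n. B\<^sup>2))"
  proof (intro mult_left_mono sum_mono)
    fix i assume "i \<in> {..<?n}"
    then have "vs ! i \<in> set vs" by simp
    then show "(\<Sum>k\<in>F. (norm (fourier (vs ! i) k))\<^sup>2) \<le> B\<^sup>2"
      using bessel[of "vs ! i" B F] v B F by blast
  qed auto
  also have "\<dots> = (?n * E * B)\<^sup>2"
    by (simp add: power2_eq_square)
  finally show "(\<Sum>k\<in>F. (norm (fourier u k))\<^sup>2) \<le> (?n * E * B)\<^sup>2" .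
qed

section \<open>The resolvent set\<close>

lemma resolvent_properties:
  assumes "z \<notin> spectrum D A"
  shows resolvent_in_domain: "resolvent D A z x \<in> D"
    and resolvent_right_inverse: "z *\<^sub>C resolvent D A z x - A (resolvent D A z x) = x"
    and resolvent_left_inverse: "q \<in> D \<Longrightarrow> resolvent D A z (z *\<^sub>C q - A q) = q"
    and bounded_clinear_resolvent: "bounded_clinear (resolvent D A z)"
proof -
  have bij: "bij_betw (\<lambda>x. z *\<^sub>C x - A x) D UNIV" and "bounded_clinear (resolvent D A z)"
    using assms by (auto simp: spectrum_def)
  then show "bounded_clinear (resolvent D A z)" by simp
  have surj: "x \<in> (\<lambda>x. z *\<^sub>C x - A x) ` D" and inj: "inj_on (\<lambda>x. z *\<^sub>C x - A x) D"
    using bij by (auto simp: bij_betw_def)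
  show "resolvent D A z x \<in> D"
    unfolding resolvent_def by (rule inv_into_into[OF surj])
  show "z *\<^sub>C resolvent D A z x - A (resolvent D A z x) = x"
    unfolding resolvent_def by (rule f_inv_into_f[OF surj])
  show "q \<in> D \<Longrightarrow> resolvent D A z (z *\<^sub>C q - A q) = q"
    unfolding resolvent_def by (rule inv_into_f_f[OF inj])
qed

lemma bounded_clinearD:
  assumes "bounded_clinear f"
  shows "bounded_linear f" "f (c *\<^sub>C x) = c *\<^sub>C f x"
  using assms by (auto simp: bounded_clinear_def)

lemma contraction_has_fixed_point:
  fixes f :: "'a::banach \<Rightarrow> 'a"
  assumes "0 \<le> c" "c < 1" "\<And>x y. norm (f x - f y) \<le> c * norm (x - y)"
  obtains w where "f w = w"
  using banach_fix_type[of c f] assms by (auto simp: dist_norm)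

text \<open>
  The equation \<open>z w - A w = y\<close> is equivalent to the fixed point equation
  \<open>w = R(z\<^sub>0,A) (y + (z\<^sub>0 - z) w)\<close>, whose right-hand side is a contraction in \<open>w\<close>.
\<close>

lemma resolvent_set_perturbation:
  fixes A :: "'a::complex_hilbert_space \<Rightarrow> 'a"
  assumes z0: "z0 \<notin> spectrum D A"
    and N: "\<And>x. norm (resolvent D A z0 x) \<le> N * norm x"
    and small: "cmod (z0 - z) * N < 1"
  shows "z \<notin> spectrum D A"
proof -
  define R where "R = resolvent D A z0"
  define S where "S = resolvent D A z"
  note R_bcl = bounded_clinear_resolvent[OF z0, folded R_def]
  note R_lin = bounded_clinearD(1)[OF R_bcl]
  note R_add = linear_add[OF bounded_linear.linear[OF R_lin]]
  note R_diff = linear_diff[OF bounded_linear.linear[OF R_lin]]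
  have contr: "norm (R ((z0 - z) *\<^sub>C d)) \<le> (cmod (z0 - z) * N) * norm d" for d
    using N[of "(z0 - z) *\<^sub>C d"] by (simp add: R_def mult_ac)
  \<comment> \<open>Uniqueness of fixed points; it also makes the solution operator linear.\<close>
  have fixed_zero: "d = 0" if "d = R ((z0 - z) *\<^sub>C d)" for d
  proof (rule ccontr)
    assume "d \<noteq> 0"
    then have "(cmod (z0 - z) * N) * norm d < 1 * norm d"
      using small by (intro mult_strict_right_mono) auto
    with contr[of d] that show False by simp
  qed
  have fixedI: "w = R (y + (z0 - z) *\<^sub>C w)" if "w \<in> D" "z *\<^sub>C w - A w = y" for w y
  proof -
    have "y + (z0 - z) *\<^sub>C w = z0 *\<^sub>C w - A w"
      using that(2) scaleC_add_left[of "z0 - z" z w] by (simp add: algebra_simps)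
    then show ?thesis
      using resolvent_left_inverse[OF z0 that(1)] by (simp add: R_def)
  qed
  have fixedD: "w \<in> D \<and> z *\<^sub>C w - A w = y" if "w = R (y + (z0 - z) *\<^sub>C w)" for w y
  proof -
    have "w \<in> D" using resolvent_in_domain[OF z0] that by (metis R_def)
    moreover have "z0 *\<^sub>C w - A w = y + (z0 - z) *\<^sub>C w"
      using resolvent_right_inverse[OF z0] that by (metis R_def)
    then have "z *\<^sub>C w - A w = y"
      using scaleC_add_left[of "z0 - z" z w] by (simp add: algebra_simps)
    ultimately show ?thesis by simp
  qed
  have surj: "\<exists>w\<in>D. z *\<^sub>C w - A w = y" for y
  proof -
    have "0 \<le> max 0 (cmod (z0 - z) * N)" "max 0 (cmod (z0 - z) * N) < 1" using small by auto
    moreover have "norm (R (y + (z0 - z) *\<^sub>C v) - R (y + (z0 - z) *\<^sub>C w))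
        \<le> max 0 (cmod (z0 - z) * N) * norm (v - w)" for v w
    proof -
      have "R (y + (z0 - z) *\<^sub>C v) - R (y + (z0 - z) *\<^sub>C w) = R ((z0 - z) *\<^sub>C (v - w))"
        by (simp add: scaleC_diff_right flip: R_diff)
      also have "norm \<dots> \<le> (cmod (z0 - z) * N) * norm (v - w)" by (rule contr)
      also have "\<dots> \<le> max 0 (cmod (z0 - z) * N) * norm (v - w)" by (intro mult_right_mono) auto
      finally show ?thesis .
    qed
    ultimately obtain w where "R (y + (z0 - z) *\<^sub>C w) = w"
      by (rule contraction_has_fixed_point)
    then show ?thesis using fixedD by metis
  qed
  have inj: "inj_on (\<lambda>w. z *\<^sub>C w - A w) D"
  proof (rule inj_onI)
    fix v w assume "v \<in> D" "w \<in> D" "z *\<^sub>C v - A v = z *\<^sub>C w - A w"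
    then have "v = R (z *\<^sub>C w - A w + (z0 - z) *\<^sub>C v)" "w = R (z *\<^sub>C w - A w + (z0 - z) *\<^sub>C w)"
      by (auto intro: fixedI)
    then have "v - w = R ((z0 - z) *\<^sub>C (v - w))"
      by (metis R_diff add_diff_cancel_left scaleC_diff_right)
    then show "v = w" using fixed_zero by fastforce
  qed
  have bij: "bij_betw (\<lambda>w. z *\<^sub>C w - A w) D UNIV"
    unfolding bij_betw_def using inj surj by (auto simp: image_iff) metis
  have S: "S y = R (y + (z0 - z) *\<^sub>C S y)" for y
  proof (rule fixedI)
    have "y \<in> (\<lambda>w. z *\<^sub>C w - A w) ` D" using surj[of y] by blast
    then show "S y \<in> D" "z *\<^sub>C S y - A (S y) = y"
      unfolding S_def resolvent_def by (rule inv_into_into, rule f_inv_into_f)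
  qed
  have S_add: "S (x + y) = S x + S y" for x y
  proof -
    have "S (x + y) - S x - S y
      = R ((x + y + (z0 - z) *\<^sub>C S (x + y)) - (x + (z0 - z) *\<^sub>C S x) - (y + (z0 - z) *\<^sub>C S y))"
      unfolding R_diff by (simp flip: S)
    also have "\<dots> = R ((z0 - z) *\<^sub>C (S (x + y) - S x - S y))"
      by (simp add: scaleC_diff_right scaleC_add_right algebra_simps)
    finally have "S (x + y) - S x - S y = 0" by (rule fixed_zero)
    then show ?thesis by (simp add: algebra_simps)
  qed
  have S_scaleC: "S (c *\<^sub>C x) = c *\<^sub>C S x" for c x
  proof -
    have "S (c *\<^sub>C x) - c *\<^sub>C S x
      = R ((c *\<^sub>C x + (z0 - z) *\<^sub>C S (c *\<^sub>C x)) - c *\<^sub>C (x + (z0 - z) *\<^sub>C S x))"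
      unfolding R_diff bounded_clinearD(2)[OF R_bcl] by (simp flip: S)
    also have "\<dots> = R ((z0 - z) *\<^sub>C (S (c *\<^sub>C x) - c *\<^sub>C S x))"
      by (simp add: scaleC_diff_right scaleC_add_right scaleC_scaleC mult.commute)
    finally have "S (c *\<^sub>C x) - c *\<^sub>C S x = 0" by (rule fixed_zero)
    then show ?thesis by simp
  qed
  have "bounded_linear S"
  proof (rule bounded_linear_intro)
    fix x
    have "norm (S x) \<le> norm (R x) + norm (R ((z0 - z) *\<^sub>C S x))"
      using S[of x] R_add norm_triangle_ineq by metis
    also have "\<dots> \<le> N * norm x + (cmod (z0 - z) * N) * norm (S x)"
      by (intro add_mono contr) (simp add: R_def N)
    finally have "(1 - cmod (z0 - z) * N) * norm (S x) \<le> N * norm x"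
      by (simp add: algebra_simps)
    then show "norm (S x) \<le> norm x * (N / (1 - cmod (z0 - z) * N))"
      using small by (simp add: field_simps)
  qed (use S_add S_scaleC in \<open>simp_all flip: scaleC_of_real\<close>)
  then have "bounded_clinear S" by (simp add: bounded_clinear_def S_scaleC)
  with bij show ?thesis by (simp add: spectrum_def S_def)
qed

section \<open>Polynomials on the unit interval\<close>

lemma power_dvd_pderiv:
  fixes b p :: "'b::idom poly"
  assumes "b ^ Suc m dvd p"
  shows "b ^ m dvd pderiv p"
proof -
  from assms obtain r where r: "p = b ^ Suc m * r" by (rule dvdE)
  show ?thesis
    unfolding r pderiv_mult pderiv_power_Suc
    by (intro dvd_add) (auto intro: dvd_mult dvd_mult2 dvd_smult)
qed

lemma poly_bounded_unit_interval:
  obtains B where "0 \<le> B" "\<And>\<theta>. \<theta> \<in> {0..1::real} \<Longrightarrow> \<bar>poly p \<theta>\<bar> \<le> B"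
proof -
  have "compact (poly p ` {0..1})"
    by (intro compact_continuous_image continuous_intros compact_Icc)
  from compact_imp_bounded[OF this] obtain B where "0 < B" "\<forall>x\<in>{0..1}. \<bar>poly p x\<bar> \<le> B"
    by (auto simp: bounded_pos)
  then show ?thesis using that[of B] by simp
qed

section \<open>Bounded semigroups and their generators\<close>

locale bounded_semigroup_generator =
  fixes T :: "real \<Rightarrow> 'a \<Rightarrow> 'a::complex_hilbert_space"
    and D :: "'a set" and A :: "'a \<Rightarrow> 'a" and K :: real
  assumes semigroup: "C0_semigroup T"
    and generator: "is_generator D A T"
    and K_ge_1: "1 \<le> K"
    and T_bound: "\<And>t x. 0 \<le> t \<Longrightarrow> norm (T t x) \<le> K * norm x"
begin

lemma bounded_clinear_T: "0 \<le> t \<Longrightarrow> bounded_clinear (T t)"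
  and T_0 [simp]: "T 0 x = x"
  and T_plus: "0 \<le> s \<Longrightarrow> 0 \<le> t \<Longrightarrow> T (s + t) x = T s (T t x)"
  and T_tendsto: "((\<lambda>t. T t x) \<longlongrightarrow> x) (at_right 0)"
  using semigroup by (auto simp: C0_semigroup_def)

lemma T_add: "0 \<le> t \<Longrightarrow> T t (x + y) = T t x + T t y"
  and T_diff: "0 \<le> t \<Longrightarrow> T t (x - y) = T t x - T t y"
  and T_scaleR: "0 \<le> t \<Longrightarrow> T t (r *\<^sub>R x) = r *\<^sub>R T t x"
  and T_scaleC: "0 \<le> t \<Longrightarrow> T t (c *\<^sub>C x) = c *\<^sub>C T t x"
  using bounded_clinearD[OF bounded_clinear_T]
  by (auto simp: linear_add linear_diff linear_scale bounded_linear.linear)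

lemma generator_tendsto:
  "q \<in> D \<Longrightarrow> ((\<lambda>h. (T h q - q) /\<^sub>R h) \<longlongrightarrow> A q) (at_right 0)"
  using generator by (simp add: is_generator_def)

lemma generator_commutes:
  assumes q: "q \<in> D" and t: "0 \<le> t"
  shows "T t q \<in> D" "A (T t q) = T t (A q)"
proof -
  have "((\<lambda>h. T t ((T h q - q) /\<^sub>R h)) \<longlongrightarrow> T t (A q)) (at_right 0)"
    by (rule bounded_linear.tendsto[OF bounded_clinearD(1)[OF bounded_clinear_T[OF t]]
        generator_tendsto[OF q]])
  moreover have "\<forall>\<^sub>F h in at_right 0. T t ((T h q - q) /\<^sub>R h) = (T h (T t q) - T t q) /\<^sub>R h"
    using eventually_at_right_less
    by eventually_elim (use t in \<open>simp add: T_diff T_scaleR add.commute flip: T_plus\<close>)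
  ultimately have lim: "((\<lambda>h. (T h (T t q) - T t q) /\<^sub>R h) \<longlongrightarrow> T t (A q)) (at_right 0)"
    by (rule Lim_transform_eventually)
  then show D: "T t q \<in> D"
    using generator by (auto simp: is_generator_def)
  show "A (T t q) = T t (A q)"
    by (rule tendsto_unique[OF _ generator_tendsto[OF D] lim]) simp
qed

lemma continuous_on_T: "continuous_on {0..} (\<lambda>t. T t x)"
proof (rule continuous_onI)
  fix t e :: real assume "0 < e" and t: "t \<in> {0..}"
  then have "0 < e / K" using K_ge_1 by simp
  with T_tendsto[of x] have "\<forall>\<^sub>F h in at_right 0. dist (T h x) x < e / K"
    by (rule tendstoD)
  then obtain d where d: "d > 0" "\<And>h. 0 < h \<Longrightarrow> h < d \<Longrightarrow> dist (T h x) x < e / K"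
    by (auto simp: eventually_at_right_field)
  have increment: "dist (T (r + h) x) (T r x) \<le> e" if "0 \<le> r" "0 \<le> h" "h < d" for r h
  proof -
    have "dist (T (r + h) x) (T r x) = norm (T r (T h x - x))"
      using that by (simp add: T_plus T_diff dist_norm)
    also have "\<dots> \<le> K * norm (T h x - x)" by (rule T_bound) fact
    also have "\<dots> \<le> K * (e / K)"
      using d(2)[of h] that \<open>0 < e\<close> K_ge_1
      by (intro mult_left_mono) (cases "h = 0"; force simp: dist_norm less_imp_le)+
    finally show ?thesis using K_ge_1 by simp
  qed
  have "dist (T s x) (T t x) \<le> e" if "s \<in> {0..}" "dist s t < d" for s
  proof (cases "s \<le> t")
    case True
    with increment[of s "t - s"] that t show ?thesis by (simp add: dist_commute dist_real_def)
  next
    case False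
    with increment[of t "s - t"] that t show ?thesis by (simp add: dist_real_def)
  qed
  with d(1) show "\<exists>d>0. \<forall>s\<in>{0..}. dist s t < d \<longrightarrow> dist (T s x) (T t x) \<le> e" by blast
qed

text \<open>
  Both one-sided difference quotients are, up to an operator \<open>T s\<close> of norm at most \<open>K\<close>, difference
  quotients at time \<open>0\<close>; on the left the value \<open>A q\<close> is shifted by \<open>t - s\<close> in addition.
\<close>

lemma orbit_has_vector_derivative:
  assumes q: "q \<in> D" and t: "0 \<le> t"
  shows "((\<lambda>t. T t q) has_vector_derivative T t (A q)) (at t within {0..})"
  unfolding has_vector_derivative_def has_derivative_within_alt
proof (intro conjI allI impI bounded_linear_scaleR_left)
  fix e :: real assume e: "0 < e"
  then have e': "0 < e / (2 * K)" using K_ge_1 by simp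
  from tendstoD[OF generator_tendsto[OF q] e'] tendstoD[OF T_tendsto[of "A q"] e']
  have "\<forall>\<^sub>F h in at_right 0. dist ((T h q - q) /\<^sub>R h) (A q) < e / (2 * K)
      \<and> dist (T h (A q)) (A q) < e / (2 * K)"
    by (rule eventually_conj)
  then obtain d where d: "d > 0" "\<And>h. 0 < h \<Longrightarrow> h < d \<Longrightarrow>
      dist ((T h q - q) /\<^sub>R h) (A q) < e / (2 * K) \<and> dist (T h (A q)) (A q) < e / (2 * K)"
    by (auto simp: eventually_at_right_field)
  have quotient: "norm (T h q - q - h *\<^sub>R A q) \<le> h * (e / (2 * K))" if "0 < h" "h < d" for h
  proof -
    have "T h q - q - h *\<^sub>R A q = h *\<^sub>R ((T h q - q) /\<^sub>R h - A q)"
      using that by (simp add: scaleR_diff_right)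
    also have "norm \<dots> \<le> h * (e / (2 * K))"
      unfolding norm_scaleR abs_of_pos[OF that(1)]
      using d(2)[OF that] that by (intro mult_left_mono) (simp_all add: dist_norm)
    finally show ?thesis .
  qed
  have "norm (T s q - T t q - (s - t) *\<^sub>R T t (A q)) \<le> e * norm (s - t)"
    if s: "s \<in> {0..}" "norm (s - t) < d" for s
  proof (cases s t rule: linorder_cases)
    case equal
    then show ?thesis by simp
  next
    case greater
    have "T s q - T t q - (s - t) *\<^sub>R T t (A q) = T t (T (s - t) q - q - (s - t) *\<^sub>R A q)"
      using greater t T_plus[of t "s - t" q] by (simp add: T_diff T_scaleR)
    also have "norm \<dots> \<le> K * norm (T (s - t) q - q - (s - t) *\<^sub>R A q)" by (rule T_bound[OF t])
    also have "\<dots> \<le> K * ((s - t) * (e / (2 * K)))"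
      using greater s K_ge_1 by (intro mult_left_mono quotient) auto
    also have "\<dots> \<le> e * norm (s - t)"
      using greater K_ge_1 e by (simp add: field_simps)
    finally show ?thesis .
  next
    case less
    let ?h = "t - s"
    have 0: "0 \<le> s" "0 < ?h" "?h < d" using s less by auto
    have "T s q - T t q - (s - t) *\<^sub>R T t (A q)
       = T s (?h *\<^sub>R (T ?h (A q) - A q) - (T ?h q - q - ?h *\<^sub>R A q))"
      using 0 T_plus[of s ?h q] T_plus[of s ?h "A q"]
      by (simp add: T_diff T_scaleR scaleR_diff_right) (simp add: algebra_simps)
    also have "norm \<dots> \<le> K * norm (?h *\<^sub>R (T ?h (A q) - A q) - (T ?h q - q - ?h *\<^sub>R A q))"
      by (rule T_bound) fact
    also have "\<dots> \<le> K * (?h * (e / (2 * K)) + ?h * (e / (2 * K)))"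
    proof (rule mult_left_mono[OF order_trans[OF norm_triangle_ineq4 add_mono]])
      show "norm (?h *\<^sub>R (T ?h (A q) - A q)) \<le> ?h * (e / (2 * K))"
        unfolding norm_scaleR abs_of_pos[OF 0(2)]
        using d(2)[of ?h] 0 by (intro mult_left_mono) (simp_all add: dist_norm)
      show "norm (T ?h q - q - ?h *\<^sub>R A q) \<le> ?h * (e / (2 * K))"
        by (rule quotient[OF 0(2,3)])
    qed (use K_ge_1 in simp)
    also have "\<dots> = e * norm (s - t)" using 0 K_ge_1 by (simp add: field_simps)
    finally show ?thesis .
  qed
  with d(1) show "\<exists>d>0. \<forall>y\<in>{0..}. norm (y - t) < d \<longrightarrow>
      norm (T y q - T t q - (y - t) *\<^sub>R T t (A q)) \<le> e * norm (y - t)" by blast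
qed

lemma resolvent_T_commute:
  assumes z: "z \<notin> spectrum D A" and t: "0 \<le> t"
  shows "resolvent D A z (T t x) = T t (resolvent D A z x)"
proof -
  let ?q = "resolvent D A z x"
  have q: "?q \<in> D" by (rule resolvent_in_domain[OF z])
  have "T t x = T t (z *\<^sub>C ?q - A ?q)" by (simp add: resolvent_right_inverse[OF z])
  also have "\<dots> = z *\<^sub>C T t ?q - A (T t ?q)"
    by (simp add: T_diff T_scaleC t generator_commutes[OF q t])
  finally show ?thesis
    using resolvent_left_inverse[OF z generator_commutes(1)[OF q t]] by simp
qed

text \<open>
  Right invertibility of \<open>1 - A\<close>, with a bounded right inverse, by the Laplace transform cut off at a
  time \<open>P\<close> at which \<open>exp (- P) T(P)\<close> has norm at most \<open>1/2\<close>.  With \<open>L x\<close> for the truncated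
  transform, \<open>L (q - A q) = q - exp (- P) T(P) q\<close> on the domain, and \<open>1 - exp (- P) T(P)\<close> is
  invertible.  That \<open>L w\<close> belongs to the domain is read off from a known resolvent, which commutes
  with \<open>L\<close>.
\<close>

lemma resolvent_at_one:
  assumes z0: "z0 \<notin> spectrum D A"
  obtains C where "C \<ge> 0" and "\<And>x. resolvent D A 1 x \<in> D"
    and "\<And>x. resolvent D A 1 x - A (resolvent D A 1 x) = x"
    and "\<And>x. norm (resolvent D A 1 x) \<le> C * norm x"
proof -
  define R where "R = resolvent D A z0"
  note R_lin = bounded_clinearD(1)[OF bounded_clinear_resolvent[OF z0, folded R_def]]
  note R_scaleC = bounded_clinearD(2)[OF bounded_clinear_resolvent[OF z0, folded R_def]]
  note R_diff = linear_diff[OF bounded_linear.linear[OF R_lin]]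
  note R_scaleR = linear_scale[OF bounded_linear.linear[OF R_lin]]
  \<comment> \<open>Chosen so that \<open>exp (- P) K = 1/2\<close>.\<close>
  define P where "P = ln (2 * K)"
  have P: "P \<ge> 0" "exp (- P) * K = 1 / 2"
    using K_ge_1 by (auto simp: P_def exp_minus field_simps)
  define L where "L = (\<lambda>x. integral {0..P} (\<lambda>s. exp (- s) *\<^sub>R T s x))"
  have T_cont: "continuous_on {0..P} (\<lambda>s. T s x)" for x
    by (rule continuous_on_subset[OF continuous_on_T]) auto
  have int: "(\<lambda>s. exp (- s) *\<^sub>R T s x) integrable_on {0..P}" for x
    by (intro integrable_continuous_real continuous_intros T_cont)
  have half: "norm (exp (- P) *\<^sub>R T P x) \<le> 1 / 2 * norm x" for x
    using mult_left_mono[OF T_bound[OF P(1), of x], of "exp (- P)"] P(2)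
    by (simp flip: mult.assoc)
  have L_id_minus_A: "L (q - A q) = q - exp (- P) *\<^sub>R T P q" if q: "q \<in> D" for q
  proof -
    have "((\<lambda>s. - (exp (- s) *\<^sub>R T s (q - A q))) has_integral
        exp (- P) *\<^sub>R T P q - exp (- 0) *\<^sub>R T 0 q) {0..P}"
    proof (rule fundamental_theorem_of_calculus[OF P(1)])
      fix s :: real assume s: "s \<in> {0..P}"
      have "((\<lambda>s. exp (- s)) has_field_derivative - exp (- s)) (at s within {0..P})"
        by (auto intro!: derivative_eq_intros)
      moreover have "((\<lambda>s. T s q) has_vector_derivative T s (A q)) (at s within {0..P})"
        using s by (intro has_vector_derivative_within_subset[OF orbit_has_vector_derivative[OF q]]) auto
      ultimately show "((\<lambda>s. exp (- s) *\<^sub>R T s q) has_vector_derivative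
          - (exp (- s) *\<^sub>R T s (q - A q))) (at s within {0..P})"
        by (rule has_vector_derivative_eq_rhs[OF has_vector_derivative_scaleR])
           (use s in \<open>simp add: T_diff algebra_simps\<close>)
    qed
    then have "- L (q - A q) = exp (- P) *\<^sub>R T P q - q"
      unfolding L_def integral_neg[symmetric] by (simp only: integral_unique T_0 minus_zero exp_zero scaleR_one)
    then show ?thesis by (simp add: algebra_simps minus_equation_iff)
  qed
  have L_R: "R (L x) = L (R x)" for x
  proof -
    have "R (L x) = integral {0..P} (\<lambda>s. R (exp (- s) *\<^sub>R T s x))"
      unfolding L_def using integral_linear[OF int R_lin] by (simp add: o_def)
    also have "\<dots> = L (R x)"
      unfolding L_def by (intro integral_cong) (simp add: R_scaleR resolvent_T_commute[OF z0, folded R_def])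
    finally show ?thesis .
  qed
  have L_combine: "L (x + c *\<^sub>C y) = L x + c *\<^sub>C L y" for x y c
  proof -
    have "c *\<^sub>C L y = integral {0..P} (\<lambda>s. c *\<^sub>C (exp (- s) *\<^sub>R T s y))"
      unfolding L_def using integral_linear[OF int bounded_linear_scaleC_right] by (simp add: o_def)
    then have "L x + c *\<^sub>C L y
      = integral {0..P} (\<lambda>s. exp (- s) *\<^sub>R T s x + c *\<^sub>C (exp (- s) *\<^sub>R T s y))"
      unfolding L_def
      by (subst integral_add) (auto intro!: int integrable_continuous_real continuous_intros T_cont)
    also have "\<dots> = L (x + c *\<^sub>C y)"
      unfolding L_def by (intro integral_cong) (simp add: T_add T_scaleC scaleC_scaleR_right scaleR_add_right)
    finally show ?thesis by simp
  qed
  have surj: "x \<in> (\<lambda>q. 1 *\<^sub>C q - A q) ` D" for x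
  proof -
    have "norm ((x + exp (- P) *\<^sub>R T P v) - (x + exp (- P) *\<^sub>R T P w)) \<le> 1 / 2 * norm (v - w)" for v w
      using half[of "v - w"] by (simp add: T_diff P scaleR_diff_right)
    then obtain w where w: "x + exp (- P) *\<^sub>R T P w = w"
      using contraction_has_fixed_point[of "1 / 2" "\<lambda>w. x + exp (- P) *\<^sub>R T P w"] by auto
    define q where "q = R w"
    have q: "q \<in> D" "z0 *\<^sub>C q - A q = w"
      unfolding q_def R_def using resolvent_in_domain[OF z0] resolvent_right_inverse[OF z0] by auto
    \<comment> \<open>Rewriting \<open>q - A q\<close> through \<open>z0\<close> expresses \<open>L w\<close> as a value of \<open>R\<close>.\<close>
    have "q - A q = w + (1 - z0) *\<^sub>C q"
      using scaleC_add_left[of "1 - z0" z0 q] by (simp add: add.commute flip: q(2))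
    then have "L w + (1 - z0) *\<^sub>C R (L w) = q - exp (- P) *\<^sub>R T P q"
      using L_id_minus_A[OF q(1)] by (simp add: L_combine L_R q_def)
    also have "\<dots> = R (w - exp (- P) *\<^sub>R T P w)"
      unfolding q_def R_diff R_scaleR resolvent_T_commute[OF z0 P(1), folded R_def] ..
    also have "w - exp (- P) *\<^sub>R T P w = x" using w by (simp add: algebra_simps)
    finally have "L w = R (x - (1 - z0) *\<^sub>C L w)"
      by (simp add: R_diff R_scaleC algebra_simps)
    then have "L w \<in> D" "z0 *\<^sub>C L w - A (L w) = x - (1 - z0) *\<^sub>C L w"
      using resolvent_in_domain[OF z0] resolvent_right_inverse[OF z0] by (metis R_def)+
    then show ?thesis
      using scaleC_add_left[of "1 - z0" z0 "L w"] by (intro image_eqI[of _ _ "L w"]) (auto simp: algebra_simps)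
  qed
  have R1: "resolvent D A 1 x \<in> D" "resolvent D A 1 x - A (resolvent D A 1 x) = x" for x
    using inv_into_into[OF surj] f_inv_into_f[OF surj, of x] by (auto simp: resolvent_def)
  have "norm (resolvent D A 1 x) \<le> (2 * (P * K)) * norm x" for x
  proof -
    let ?q = "resolvent D A 1 x"
    have "norm (L x) \<le> integral {0..P} (\<lambda>s. K * norm x)"
      unfolding L_def
    proof (rule integral_norm_bound_integral[OF int])
      fix s :: real assume "s \<in> {0..P}"
      then have "exp (- s) * norm (T s x) \<le> 1 * (K * norm x)"
        by (intro mult_mono T_bound) auto
      then show "norm (exp (- s) *\<^sub>R T s x) \<le> K * norm x" by simp
    qed (auto intro: integrable_continuous_real)
    then have "norm (L x) \<le> P * K * norm x" using P(1) by (simp add: mult_ac)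
    moreover have "?q = L x + exp (- P) *\<^sub>R T P ?q"
      using L_id_minus_A[OF R1(1)] by (simp add: R1(2))
    then have "norm ?q \<le> norm (L x) + norm (exp (- P) *\<^sub>R T P ?q)"
      by (metis norm_triangle_ineq)
    ultimately show ?thesis using half[of ?q] by simp
  qed
  then show ?thesis using that[of "2 * (P * K)"] R1 P(1) K_ge_1 by simp
qed

section \<open>Fourier coefficients of orbits\<close>

definition orbit :: "real poly \<Rightarrow> real \<Rightarrow> 'a \<Rightarrow> real \<Rightarrow> 'a"
  where "orbit p t x \<theta> = poly p \<theta> *\<^sub>R T (t * \<theta>) x"

lemma continuous_on_orbit:
  assumes "0 \<le> t"
  shows "continuous_on {0..1} (orbit p t x)"
  unfolding orbit_def using assms
  by (intro continuous_intros continuous_on_compose2[OF continuous_on_T]) auto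

lemma orbit_integrable:
  "0 \<le> t \<Longrightarrow> (\<lambda>\<theta>. wave j \<theta> *\<^sub>C orbit p t x \<theta>) integrable_on {0..1}"
  by (intro integrable_continuous_real continuous_intros continuous_on_orbit)

lemma fourier_orbit_commute:
  assumes t: "0 \<le> t" and B: "bounded_clinear B" and comm: "\<And>s x. 0 \<le> s \<Longrightarrow> B (T s x) = T s (B x)"
  shows "fourier (orbit p t (B x)) k = B (fourier (orbit p t x) k)"
proof -
  note lin = bounded_clinearD[OF B]
  have "B (fourier (orbit p t x) k) = integral {0..1} (\<lambda>\<theta>. B (wave (- k) \<theta> *\<^sub>C orbit p t x \<theta>))"
    unfolding fourier_def using integral_linear[OF orbit_integrable[OF t] lin(1)] by (simp add: o_def)
  also have "\<dots> = fourier (orbit p t (B x)) k"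
    unfolding fourier_def orbit_def using t
    by (intro integral_cong)
       (simp add: lin(2) comm linear_scale[OF bounded_linear.linear[OF lin(1)]])
  finally show ?thesis by simp
qed

lemma fourier_orbit_diff:
  assumes t: "0 \<le> t"
  shows "fourier (orbit p t (x - y)) k = fourier (orbit p t x) k - fourier (orbit p t y) k"
proof -
  have "fourier (orbit p t x) k - fourier (orbit p t y) k
     = integral {0..1} (\<lambda>\<theta>. wave (- k) \<theta> *\<^sub>C orbit p t x \<theta> - wave (- k) \<theta> *\<^sub>C orbit p t y \<theta>)"
    unfolding fourier_def by (rule integral_diff[symmetric]) (auto intro: orbit_integrable t)
  also have "\<dots> = fourier (orbit p t (x - y)) k"
    unfolding fourier_def orbit_def using t
    by (intro integral_cong) (simp add: T_diff scaleR_diff_right scaleC_diff_right)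
  finally show ?thesis by simp
qed

text \<open>Integration by parts; the boundary terms vanish because \<open>p\<close> does.\<close>

lemma fourier_orbit_generator:
  assumes q: "q \<in> D" and t: "0 < t" and p: "poly p 0 = 0" "poly p 1 = 0"
  shows "fourier (orbit p t (A q)) k
    = (\<i> * of_real (2 * pi * k / t)) *\<^sub>C fourier (orbit p t q) k - (1 / t) *\<^sub>R fourier (orbit (pderiv p) t q) k"
proof -
  let ?w = "wave (- k)" and ?c = "2 * pi * \<i> * of_int (- k)"
  have 0: "((\<lambda>\<theta>. ?w \<theta> *\<^sub>C (t *\<^sub>R orbit p t (A q) \<theta> + orbit (pderiv p) t q \<theta>) + (?c * ?w \<theta>) *\<^sub>C orbit p t q \<theta>)
    has_integral (?w 1 *\<^sub>C orbit p t q 1 - ?w 0 *\<^sub>C orbit p t q 0)) {0..1}"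
  proof (rule fundamental_theorem_of_calculus)
    fix \<theta> :: real assume \<theta>: "\<theta> \<in> {0..1}"
    have "((\<lambda>\<theta>. t * \<theta>) has_vector_derivative t) (at \<theta> within {0..1})"
      by (auto intro!: derivative_eq_intros)
    moreover have "((\<lambda>t. T t q) has_vector_derivative T (t * \<theta>) (A q))
        (at (t * \<theta>) within (\<lambda>\<theta>. t * \<theta>) ` {0..1})"
      using t \<theta> by (intro has_vector_derivative_within_subset[OF orbit_has_vector_derivative[OF q]]) auto
    ultimately have "((\<lambda>\<theta>. T (t * \<theta>) q) has_vector_derivative t *\<^sub>R T (t * \<theta>) (A q)) (at \<theta> within {0..1})"
      by (drule_tac vector_diff_chain_within) (simp_all add: o_def)
    from has_vector_derivative_scaleR[OF has_field_derivative_at_within[OF poly_DERIV] this, of p]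
    have "(orbit p t q has_vector_derivative t *\<^sub>R orbit p t (A q) \<theta> + orbit (pderiv p) t q \<theta>) (at \<theta> within {0..1})"
      unfolding orbit_def by (rule has_vector_derivative_eq_rhs) simp
    from bounded_bilinear.has_vector_derivative[OF bounded_bilinear_scaleC wave_has_vector_derivative this, of "- k"]
    show "((\<lambda>\<theta>. ?w \<theta> *\<^sub>C orbit p t q \<theta>) has_vector_derivative
      ?w \<theta> *\<^sub>C (t *\<^sub>R orbit p t (A q) \<theta> + orbit (pderiv p) t q \<theta>) + (?c * ?w \<theta>) *\<^sub>C orbit p t q \<theta>) (at \<theta> within {0..1})"
      .
  qed simp
  have ints: "(\<lambda>\<theta>. t *\<^sub>R (?w \<theta> *\<^sub>C orbit p t (A q) \<theta>)) integrable_on {0..1}"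
    "(\<lambda>\<theta>. ?w \<theta> *\<^sub>C orbit (pderiv p) t q \<theta>) integrable_on {0..1}"
    "(\<lambda>\<theta>. ?c *\<^sub>C ?w \<theta> *\<^sub>C orbit p t q \<theta>) integrable_on {0..1}"
    using t by (intro integrable_continuous_real continuous_intros continuous_on_orbit; simp)+
  have "((\<lambda>\<theta>. t *\<^sub>R (?w \<theta> *\<^sub>C orbit p t (A q) \<theta>) + ?w \<theta> *\<^sub>C orbit (pderiv p) t q \<theta>
      + ?c *\<^sub>C ?w \<theta> *\<^sub>C orbit p t q \<theta>) has_integral 0) {0..1}"
    using 0 by (simp add: orbit_def p scaleC_add_right scaleC_scaleR_right scaleC_scaleC)
  then have "0 = integral {0..1} (\<lambda>\<theta>. t *\<^sub>R (?w \<theta> *\<^sub>C orbit p t (A q) \<theta>) + ?w \<theta> *\<^sub>C orbit (pderiv p) t q \<theta>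
      + ?c *\<^sub>C ?w \<theta> *\<^sub>C orbit p t q \<theta>)"
    by (simp only: integral_unique)
  also have "\<dots> = integral {0..1} (\<lambda>\<theta>. t *\<^sub>R (?w \<theta> *\<^sub>C orbit p t (A q) \<theta>))
      + integral {0..1} (\<lambda>\<theta>. ?w \<theta> *\<^sub>C orbit (pderiv p) t q \<theta>)
      + integral {0..1} (\<lambda>\<theta>. ?c *\<^sub>C ?w \<theta> *\<^sub>C orbit p t q \<theta>)"
    by (simp only: integral_add ints integrable_add)
  also have "integral {0..1} (\<lambda>\<theta>. ?c *\<^sub>C ?w \<theta> *\<^sub>C orbit p t q \<theta>) = ?c *\<^sub>C fourier (orbit p t q) k"
    unfolding fourier_def
    using integral_linear[OF orbit_integrable bounded_linear_scaleC_right] t by (simp add: o_def)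
  finally have eq: "t *\<^sub>R fourier (orbit p t (A q)) k = - (?c *\<^sub>C fourier (orbit p t q) k) - fourier (orbit (pderiv p) t q) k"
    unfolding fourier_def integral_cmul by (simp add: algebra_simps eq_neg_iff_add_eq_0)
  have "fourier (orbit p t (A q)) k = (1 / t) *\<^sub>R (t *\<^sub>R fourier (orbit p t (A q)) k)"
    using t by simp
  also have "\<dots> = (1 / t) *\<^sub>R (- (?c *\<^sub>C fourier (orbit p t q) k)) - (1 / t) *\<^sub>R fourier (orbit (pderiv p) t q) k"
    by (simp only: eq scaleR_diff_right)
  also have "(1 / t) *\<^sub>R (- (?c *\<^sub>C fourier (orbit p t q) k)) = complex_of_real (1 / t) *\<^sub>C (- 1) *\<^sub>C (?c *\<^sub>C fourier (orbit p t q) k)"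
    by (metis of_real_1 of_real_minus scaleC_of_real scaleR_minus1_left)
  also have "\<dots> = (\<i> * of_real (2 * pi * k / t)) *\<^sub>C fourier (orbit p t q) k"
    unfolding scaleC_scaleC by (simp add: mult_ac)
  finally show ?thesis .
qed

text \<open>
  For \<open>x = z q - A q\<close> with \<open>z = 2\<pi>ik/t\<close> the term \<open>z c\<^sub>k(p; q)\<close> cancels in the previous lemma, leaving
  the coefficient of \<open>p'\<close> at \<open>q = R(z,A) x\<close>.  The resolvent commutes with the semigroup and
  can be moved out of the integral.
\<close>

lemma fourier_orbit_resolvent_bound:
  assumes t: "0 < t" and p: "poly p 0 = 0" "poly p 1 = 0"
    and z: "\<i> * of_real (2 * pi * k / t) \<notin> spectrum D A"
    and N: "\<And>x. norm (resolvent D A (\<i> * of_real (2 * pi * k / t)) x) \<le> N * norm x"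
  shows "norm (fourier (orbit p t x) k) \<le> N / t * norm (fourier (orbit (pderiv p) t x) k)"
proof -
  let ?z = "\<i> * of_real (2 * pi * k / t) :: complex"
  define q where "q = resolvent D A ?z x"
  have q: "q \<in> D" "?z *\<^sub>C q - A q = x"
    unfolding q_def by (rule resolvent_in_domain[OF z], rule resolvent_right_inverse[OF z])
  have "bounded_clinear (\<lambda>x. ?z *\<^sub>C x)"
    unfolding bounded_clinear_def
    by (auto simp: scaleC_scaleC mult.commute bounded_linear_scaleC_right)
  then have "fourier (orbit p t (?z *\<^sub>C q)) k = ?z *\<^sub>C fourier (orbit p t q) k"
    using t by (intro fourier_orbit_commute) (auto simp: T_scaleC)
  moreover have "fourier (orbit p t x) k = fourier (orbit p t (?z *\<^sub>C q)) k - fourier (orbit p t (A q)) k"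
    using fourier_orbit_diff[of t p "?z *\<^sub>C q" "A q" k] t q(2) by simp
  ultimately have "fourier (orbit p t x) k = (1 / t) *\<^sub>R fourier (orbit (pderiv p) t q) k"
    unfolding fourier_orbit_generator[OF q(1) t p] by simp
  also have "fourier (orbit (pderiv p) t q) k = resolvent D A ?z (fourier (orbit (pderiv p) t x) k)"
    unfolding q_def using t
    by (intro fourier_orbit_commute bounded_clinear_resolvent[OF z] resolvent_T_commute[OF z]) auto
  finally show ?thesis
    using N[of "fourier (orbit (pderiv p) t x) k"] t by (simp add: divide_right_mono)
qed

lemma fourier_orbit_resolvent_bound_iterated:
  assumes t: "0 < t" and z: "\<i> * of_real (2 * pi * k / t) \<notin> spectrum D A"
    and N: "0 \<le> N" "\<And>x. norm (resolvent D A (\<i> * of_real (2 * pi * k / t)) x) \<le> N * norm x"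
    and dvd: "[:0, 1, -1:] ^ m dvd p"
  shows "norm (fourier (orbit p t x) k) \<le> (N / t) ^ m * norm (fourier (orbit ((pderiv ^^ m) p) t x) k)"
  using dvd
proof (induction m arbitrary: p)
  case 0
  then show ?case by simp
next
  case (Suc m)
  from Suc.prems obtain r where r: "p = [:0, 1, -1:] ^ Suc m * r" by (rule dvdE)
  have "poly p 0 = 0" "poly p 1 = 0" by (simp_all add: r)
  then have "norm (fourier (orbit p t x) k) \<le> N / t * norm (fourier (orbit (pderiv p) t x) k)"
    by (intro fourier_orbit_resolvent_bound t z N)
  also have "\<dots> \<le> N / t * ((N / t) ^ m * norm (fourier (orbit ((pderiv ^^ m) (pderiv p)) t x) k))"
  proof (intro mult_left_mono Suc.IH)
    show "[:0, 1, -1:] ^ m dvd pderiv p"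
      by (rule power_dvd_pderiv[OF Suc.prems])
  qed (use N t in auto)
  finally show ?case by (simp add: mult.assoc funpow_swap1)
qed

section \<open>Decay of orbits starting in the range of the generator\<close>

lemma norm_T_le_orbit_integral:
  assumes t: "0 \<le> t"
  shows "integral {0..1} (\<lambda>\<theta>. (poly p \<theta>)\<^sup>2) * (norm (T t y))\<^sup>2
    \<le> K\<^sup>2 * integral {0..1} (\<lambda>\<theta>. (norm (orbit p t y \<theta>))\<^sup>2)"
proof -
  have "integral {0..1} (\<lambda>\<theta>. (poly p \<theta>)\<^sup>2 * (norm (T t y))\<^sup>2)
      \<le> integral {0..1} (\<lambda>\<theta>. K\<^sup>2 * (norm (orbit p t y \<theta>))\<^sup>2)"
  proof (rule integral_le)
    fix \<theta> :: real assume \<theta>: "\<theta> \<in> {0..1}"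
    then have "0 \<le> t * \<theta>" "0 \<le> t - t * \<theta>" using t by (auto simp: mult_left_le)
    then have "norm (T t y) \<le> K * norm (T (t * \<theta>) y)"
      using T_plus[of "t - t * \<theta>" "t * \<theta>" y] T_bound[of "t - t * \<theta>"] by simp
    then have "(norm (T t y))\<^sup>2 \<le> (K * norm (T (t * \<theta>) y))\<^sup>2"
      by (intro power_mono) auto
    from mult_left_mono[OF this zero_le_power2[of "poly p \<theta>"]]
    show "(poly p \<theta>)\<^sup>2 * (norm (T t y))\<^sup>2 \<le> K\<^sup>2 * (norm (orbit p t y \<theta>))\<^sup>2"
      by (simp add: orbit_def power_mult_distrib mult_ac)
  qed (intro integrable_continuous_real continuous_intros continuous_on_orbit t)+
  then show ?thesis by simp
qed

text \<open>
  The three ranges of frequencies.  The number \<open>N \<omega>\<close> bounds the resolvent in the middle range;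
  its two upper bounds are what is left of the function \<open>M\<close> at this point.
\<close>

lemma fourier_orbit_generator_bound:
  assumes q: "q \<in> D" and r: "1 \<le> r" "r \<le> t" and dvd: "[:0, 1, -1:] ^ Suc n dvd p"
    and axis: "\<And>\<omega>. \<omega> \<noteq> 0 \<Longrightarrow> \<i> * of_real \<omega> \<notin> spectrum D A"
    and high: "\<And>\<omega> x. 1 \<le> \<bar>\<omega>\<bar> \<Longrightarrow> norm (resolvent D A (\<i> * of_real \<omega>) x) \<le> L * norm x" and L: "0 \<le> L"
    and mid: "\<And>\<omega> x. 1 / r < \<bar>\<omega>\<bar> \<Longrightarrow> \<bar>\<omega>\<bar> \<le> 1 \<Longrightarrow> norm (resolvent D A (\<i> * of_real \<omega>) x) \<le> N \<omega> * norm x"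
    and N: "\<And>\<omega>. 1 / r < \<bar>\<omega>\<bar> \<Longrightarrow> \<bar>\<omega>\<bar> \<le> 1 \<Longrightarrow> 0 \<le> N \<omega> \<and> N \<omega> \<le> t \<and> \<bar>\<omega>\<bar> * N \<omega> ^ Suc n \<le> C * t ^ Suc n / r"
    and C: "0 \<le> C"
  shows "norm (fourier (orbit p t (A q)) k) \<le> (1 + C + L ^ Suc n) / r *
    (\<Sum>v\<leftarrow>[orbit p t q, orbit (pderiv p) t q, orbit ((pderiv ^^ Suc n) p) t q,
        orbit ((pderiv ^^ Suc n) p) t (A q)]. norm (fourier v k))"
    (is "?lhs \<le> ?E / r * ?S")
proof -
  define \<omega> where "\<omega> = 2 * pi * of_int k / t"
  have t: "0 < t" using r by simp
  have r_t: "1 / t \<le> 1 / r" using r by (simp add: frac_le)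
  obtain s where s: "p = [:0, 1, -1:] ^ Suc n * s" using dvd by (rule dvdE)
  have p: "poly p 0 = 0" "poly p 1 = 0" by (simp_all add: s)
  let ?a = "norm (fourier (orbit p t q) k)" and ?b = "norm (fourier (orbit (pderiv p) t q) k)"
    and ?c = "norm (fourier (orbit ((pderiv ^^ Suc n) p) t q) k)"
    and ?d = "norm (fourier (orbit ((pderiv ^^ Suc n) p) t (A q)) k)"
  have S: "?S = ?a + ?b + ?c + ?d" by simp
  have E: "1 \<le> ?E" "C + 1 \<le> ?E" "L ^ Suc n \<le> ?E" using C L by auto
  have enough: "e * z \<le> ?E / r * ?S" if "e \<le> ?E / r" "0 \<le> z" "z \<le> ?S" for e z :: real
    using that E(1) r by (intro mult_mono) auto
  have split: "?lhs \<le> \<bar>\<omega>\<bar> * ?a + 1 / t * ?b"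
  proof -
    have "?lhs \<le> norm ((\<i> * of_real \<omega>) *\<^sub>C fourier (orbit p t q) k)
        + norm ((1 / t) *\<^sub>R fourier (orbit (pderiv p) t q) k)"
      unfolding fourier_orbit_generator[OF q t p] \<omega>_def by (rule norm_triangle_ineq4)
    then show ?thesis using t by (simp add: norm_mult)
  qed
  consider "\<bar>\<omega>\<bar> \<le> 1 / r" | "1 / r < \<bar>\<omega>\<bar>" "\<bar>\<omega>\<bar> \<le> 1" | "1 < \<bar>\<omega>\<bar>" by linarith
  then show ?thesis
  proof cases
    case 1
    have "?lhs \<le> 1 / r * ?a + 1 / r * ?b"
      using 1 r_t by (intro order_trans[OF split] add_mono mult_right_mono) auto
    also have "\<dots> = 1 / r * (?a + ?b)" by (simp add: algebra_simps)
    also have "\<dots> \<le> ?E / r * ?S"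
      by (rule enough) (use E r in \<open>auto simp: S intro: divide_right_mono\<close>)
    finally show ?thesis .
  next
    case 2
    have "0 < 1 / r" using r by simp
    then have z: "\<i> * of_real \<omega> \<notin> spectrum D A" using 2 by (intro axis) auto
    note N = N[OF 2] and mid = mid[OF 2]
    \<comment> \<open>\<open>Suc n\<close> resolvents for \<open>p\<close>, but only \<open>n\<close> for its derivative: both lead to the same coefficient \<open>?c\<close>.\<close>
    have a: "?a \<le> (N \<omega> / t) ^ Suc n * ?c"
      using fourier_orbit_resolvent_bound_iterated[OF t _ _ _ dvd, of k] z N mid
      unfolding \<omega>_def by blast
    have b: "?b \<le> (N \<omega> / t) ^ n * ?c"
      using fourier_orbit_resolvent_bound_iterated[OF t _ _ _ power_dvd_pderiv[OF dvd], of k] z N mid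
      unfolding \<omega>_def funpow_Suc_right o_def by blast
    have "\<bar>\<omega>\<bar> * (N \<omega> / t) ^ Suc n = \<bar>\<omega>\<bar> * N \<omega> ^ Suc n / t ^ Suc n"
      by (simp add: power_divide)
    also have "\<dots> \<le> C * t ^ Suc n / r / t ^ Suc n"
      using N t by (intro divide_right_mono) auto
    also have "\<dots> = C / r" using t by simp
    finally have wa: "\<bar>\<omega>\<bar> * (N \<omega> / t) ^ Suc n \<le> C / r" .
    have "1 / t * (N \<omega> / t) ^ n \<le> 1 / r * 1"
      using N t r r_t by (intro mult_mono power_le_one) auto
    then have wb: "1 / t * (N \<omega> / t) ^ n \<le> 1 / r" by simp
    have "?lhs \<le> \<bar>\<omega>\<bar> * ((N \<omega> / t) ^ Suc n * ?c) + 1 / t * ((N \<omega> / t) ^ n * ?c)"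
      using t by (intro order_trans[OF split] add_mono mult_left_mono a b) auto
    also have "\<dots> = (\<bar>\<omega>\<bar> * (N \<omega> / t) ^ Suc n + 1 / t * (N \<omega> / t) ^ n) * ?c"
      by (simp only: algebra_simps)
    also have "\<dots> \<le> (C / r + 1 / r) * ?c"
      by (intro mult_right_mono add_mono wa wb) simp
    also have "\<dots> \<le> ?E / r * ?S"
    proof (rule enough)
      show "C / r + 1 / r \<le> ?E / r"
        unfolding add_divide_distrib[symmetric] using E r by (intro divide_right_mono) auto
    qed (auto simp: S)
    finally show ?thesis .
  next
    case 3
    then have z: "\<i> * of_real \<omega> \<notin> spectrum D A" by (intro axis) auto
    have L': "norm (resolvent D A (\<i> * of_real \<omega>) x) \<le> L * norm x" for x
      using 3 by (intro high) auto
    \<comment> \<open>Here the weight \<open>\<bar>\<omega>\<bar>\<close> is unbounded, so the resolvent identity is applied to \<open>A q\<close> itself.\<close>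
    have "?lhs \<le> (L / t) ^ Suc n * ?d"
      using fourier_orbit_resolvent_bound_iterated[OF t _ L _ dvd, of k] z L'
      unfolding \<omega>_def by blast
    also have "\<dots> \<le> ?E / r * ?S"
    proof (rule enough)
      have "(L / t) ^ Suc n = L ^ Suc n / t ^ Suc n" by (simp add: power_divide)
      also have "\<dots> \<le> L ^ Suc n / r"
      proof (rule divide_left_mono)
        have "t ^ 1 \<le> t ^ Suc n" using r by (intro power_increasing) auto
        then show "r \<le> t ^ Suc n" using r(2) by (simp only: power_one_right)
      qed (use L r t in auto)
      also have "\<dots> \<le> ?E / r" using E r by (intro divide_right_mono) auto
      finally show "(L / t) ^ Suc n \<le> ?E / r" .
    qed (auto simp: S)
    finally show ?thesis .
  qed
qed

text \<open>
  The constant \<open>H\<close> is independent of \<open>t\<close> since the orbits are rescaled to the unit interval: there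
  the polynomial \<open>p\<close> and its derivatives are fixed functions.
\<close>

lemma generator_orbit_decay:
  assumes axis: "\<And>\<omega>. \<omega> \<noteq> 0 \<Longrightarrow> \<i> * of_real \<omega> \<notin> spectrum D A"
    and high: "\<And>\<omega> x. 1 \<le> \<bar>\<omega>\<bar> \<Longrightarrow> norm (resolvent D A (\<i> * of_real \<omega>) x) \<le> L * norm x" and L: "0 \<le> L"
    and C: "0 \<le> C"
  obtains H where "0 \<le> H"
    and "\<And>q g r t N. q \<in> D \<Longrightarrow> norm q \<le> g \<Longrightarrow> norm (A q) \<le> g \<Longrightarrow> 1 \<le> r \<Longrightarrow> r \<le> t \<Longrightarrow>
      (\<And>\<omega> x. 1 / r < \<bar>\<omega>\<bar> \<Longrightarrow> \<bar>\<omega>\<bar> \<le> 1 \<Longrightarrow> norm (resolvent D A (\<i> * of_real \<omega>) x) \<le> N \<omega> * norm x) \<Longrightarrow>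
      (\<And>\<omega>. 1 / r < \<bar>\<omega>\<bar> \<Longrightarrow> \<bar>\<omega>\<bar> \<le> 1 \<Longrightarrow>
        0 \<le> N \<omega> \<and> N \<omega> \<le> t \<and> \<bar>\<omega>\<bar> * N \<omega> ^ Suc n \<le> C * t ^ Suc n / r) \<Longrightarrow>
      norm (T t (A q)) \<le> H / r * g"
proof -
  define p :: "real poly" where "p = [:0, 1, -1:] ^ Suc n"
  define p' where "p' = (pderiv ^^ Suc n) p"
  have p_ends: "poly p 0 = 0" "poly p 1 = 0" by (simp_all add: p_def)
  define \<beta> where "\<beta> = integral {0..1} (\<lambda>\<theta>. (poly p \<theta>)\<^sup>2)"
  have \<beta>: "\<beta> > 0"
  proof -
    have cont: "continuous_on {0..1} (\<lambda>\<theta>. (poly p \<theta>)\<^sup>2)" by (intro continuous_intros)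
    then have "\<beta> \<ge> 0"
      unfolding \<beta>_def by (intro integral_nonneg integrable_continuous_real) simp_all
    moreover have "\<beta> \<noteq> 0"
    proof
      assume "\<beta> = 0"
      with cont have "\<forall>\<theta>\<in>{0..1}. (poly p \<theta>)\<^sup>2 = 0"
        using integral_eq_0_iff[of 0 1 "\<lambda>\<theta>. (poly p \<theta>)\<^sup>2"] by (simp add: \<beta>_def)
      then have "(poly p (1 / 2))\<^sup>2 = 0" by (rule bspec) simp
      then show False by (simp add: p_def poly_power)
    qed
    ultimately show ?thesis by simp
  qed
  obtain B1 where B1: "0 \<le> B1" "\<And>\<theta>. \<theta> \<in> {0..1} \<Longrightarrow> \<bar>poly p \<theta>\<bar> \<le> B1"
    by (rule poly_bounded_unit_interval) (rule that; blast)
  obtain B2 where B2: "0 \<le> B2" "\<And>\<theta>. \<theta> \<in> {0..1} \<Longrightarrow> \<bar>poly (pderiv p) \<theta>\<bar> \<le> B2"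
    by (rule poly_bounded_unit_interval) (rule that; blast)
  obtain B3 where B3: "0 \<le> B3" "\<And>\<theta>. \<theta> \<in> {0..1} \<Longrightarrow> \<bar>poly p' \<theta>\<bar> \<le> B3"
    by (rule poly_bounded_unit_interval) (rule that; blast)
  define B where "B = B1 + B2 + B3"
  have B0: "0 \<le> B" using B1(1) B2(1) B3(1) by (simp add: B_def)
  have B: "\<bar>poly p \<theta>\<bar> \<le> B" "\<bar>poly (pderiv p) \<theta>\<bar> \<le> B" "\<bar>poly p' \<theta>\<bar> \<le> B" if "\<theta> \<in> {0..1}" for \<theta>
    using B1(1) B2(1) B3(1) B1(2)[OF that] B2(2)[OF that] B3(2)[OF that] unfolding B_def
    by linarith+
  define E where "E = 1 + C + L ^ Suc n"
  have E: "0 \<le> E" using C L by (simp add: E_def)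
  define H where "H = 4 * E * (B * K) * K / sqrt \<beta>"
  have H: "0 \<le> H" using B0 E K_ge_1 \<beta> by (simp add: H_def)
  have "norm (T t (A q)) \<le> H / r * g"
    if q: "q \<in> D" and g: "norm q \<le> g" "norm (A q) \<le> g" and r: "1 \<le> r" "r \<le> t"
      and mid: "\<And>\<omega> x. 1 / r < \<bar>\<omega>\<bar> \<Longrightarrow> \<bar>\<omega>\<bar> \<le> 1 \<Longrightarrow> norm (resolvent D A (\<i> * of_real \<omega>) x) \<le> N \<omega> * norm x"
      and N: "\<And>\<omega>. 1 / r < \<bar>\<omega>\<bar> \<Longrightarrow> \<bar>\<omega>\<bar> \<le> 1 \<Longrightarrow>
        0 \<le> N \<omega> \<and> N \<omega> \<le> t \<and> \<bar>\<omega>\<bar> * N \<omega> ^ Suc n \<le> C * t ^ Suc n / r"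
    for q g r t N
  proof -
    have t: "0 \<le> t" using r by simp
    have g0: "0 \<le> g" using g(1) norm_ge_zero order_trans by blast
    define vs where "vs = [orbit p t q, orbit (pderiv p) t q, orbit p' t q, orbit p' t (A q)]"
    have "norm (fourier (orbit p t (A q)) k) \<le> E / r * (\<Sum>v\<leftarrow>vs. norm (fourier v k))" for k
      unfolding E_def vs_def p'_def
      by (rule fourier_orbit_generator_bound[OF q r _ axis high L mid N C]) (simp_all add: p_def)
    moreover have bound: "norm (orbit s t z \<theta>) \<le> B * (K * g)"
      if "\<bar>poly s \<theta>\<bar> \<le> B" "norm z \<le> g" "\<theta> \<in> {0..1}" for s z \<theta>
    proof -
      have "norm (T (t * \<theta>) z) \<le> K * norm z" using that t by (intro T_bound) auto
      also have "\<dots> \<le> K * g" using that K_ge_1 by (intro mult_left_mono) auto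
      finally show ?thesis unfolding orbit_def norm_scaleR real_norm_def
        using that B0 by (intro mult_mono) auto
    qed
    have "norm (v \<theta>) \<le> B * (K * g)" if "v \<in> set vs" "\<theta> \<in> {0..1}" for v \<theta>
      using that(1) bound[OF _ _ that(2)] g B[OF that(2)] by (auto simp: vs_def)
    moreover have "continuous_on {0..1} v" if "v \<in> set vs" for v
      using that continuous_on_orbit[OF t] by (auto simp: vs_def)
    moreover have "orbit p t (A q) 0 = orbit p t (A q) 1" by (simp add: orbit_def p_ends)
    ultimately have "integral {0..1} (\<lambda>\<theta>. (norm (orbit p t (A q) \<theta>))\<^sup>2)
        \<le> (length vs * (E / r) * (B * (K * g)))\<^sup>2"
      using E r by (intro parseval_domination continuous_on_orbit[OF t]) auto
    then have "K\<^sup>2 * integral {0..1} (\<lambda>\<theta>. (norm (orbit p t (A q) \<theta>))\<^sup>2)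
        \<le> K\<^sup>2 * (4 * (E / r) * (B * (K * g)))\<^sup>2"
      by (intro mult_left_mono) (simp_all add: vs_def)
    with norm_T_le_orbit_integral[OF t, of p "A q"]
    have "\<beta> * (norm (T t (A q)))\<^sup>2 \<le> K\<^sup>2 * (4 * (E / r) * (B * (K * g)))\<^sup>2"
      unfolding \<beta>_def by (rule order_trans)
    also have "\<dots> = (sqrt \<beta> * (H / r * g))\<^sup>2"
    proof -
      have "sqrt \<beta> * (H / r * g) = K * (4 * (E / r) * (B * (K * g)))"
        using \<beta> by (simp add: H_def)
      then show ?thesis by (simp only: power_mult_distrib)
    qed
    finally have "(sqrt \<beta> * norm (T t (A q)))\<^sup>2 \<le> (sqrt \<beta> * (H / r * g))\<^sup>2"
      using \<beta> by (simp add: power_mult_distrib)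
    then have "sqrt \<beta> * norm (T t (A q)) \<le> sqrt \<beta> * (H / r * g)"
      by (rule power2_le_imp_le) (use \<beta> H r g0 in simp)
    then show ?thesis
      using \<beta> by (simp only: mult_le_cancel_left_pos real_sqrt_gt_0_iff)
  qed
  with H show ?thesis by (rule that)
qed

end

section \<open>The growth function and its right inverse\<close>

text \<open>
  If \<open>\<sigma>\<close> is beyond the threshold \<open>s\<^sub>0\<close>, positive increase from \<open>\<sigma>\<close> to \<open>r\<close> gives
  \<open>M \<sigma> \<le> t (\<sigma>/r)\<^sup>\<alpha> / c\<close>, and an exponent \<open>Suc n \<ge> 1/\<alpha>\<close> turns the power of
  \<open>\<sigma>/r \<le> 1\<close> into at most \<open>\<sigma>/r\<close>.  Below \<open>s\<^sub>0\<close> the function \<open>M\<close> is bounded and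
  \<open>r \<le> t\<close> suffices.
\<close>

lemma positive_increase_absorbs_weight:
  assumes M: "mono_on {1..} M" "\<forall>s\<ge>1. 0 < M s" and pi: "positive_increase 1 M"
  obtains C :: real and n where "0 \<le> C" and "\<And>\<sigma> r t. 1 \<le> \<sigma> \<Longrightarrow> \<sigma> \<le> r \<Longrightarrow> r \<le> t \<Longrightarrow> M r \<le> t \<Longrightarrow>
    1 / \<sigma> * M \<sigma> ^ Suc n \<le> C * t ^ Suc n / r"
proof -
  from pi obtain \<alpha> c s0 where ac: "\<alpha> > 0" "0 < c" "1 \<le> s0"
    and inc: "\<And>\<mu> s. 1 \<le> \<mu> \<Longrightarrow> s0 \<le> s \<Longrightarrow> M (\<mu> * s) / M s \<ge> c * \<mu> powr \<alpha>"
    unfolding positive_increase_def by auto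
  obtain n :: nat where "1 / \<alpha> < n" using reals_Archimedean2 by blast
  then have n: "1 \<le> \<alpha> * Suc n" using ac by (simp add: field_simps)
  define C where "C = 1 / c ^ Suc n + M s0 ^ Suc n"
  have M0: "0 < M s0" using M ac by auto
  have "1 / \<sigma> * M \<sigma> ^ Suc n \<le> C * t ^ Suc n / r"
    if *: "1 \<le> \<sigma>" "\<sigma> \<le> r" "r \<le> t" "M r \<le> t" for \<sigma> r t
  proof (cases "s0 \<le> \<sigma>")
    case True
    have M\<sigma>: "0 < M \<sigma>" using M * by auto
    have r: "1 \<le> r / \<sigma>" "0 < r" using * by auto
    have "c * (r / \<sigma>) powr \<alpha> \<le> M r / M \<sigma>"
      using inc[OF r(1) True] * by simp
    then have "c * (r / \<sigma>) powr \<alpha> * M \<sigma> \<le> t"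
      using M\<sigma> *(4) by (simp add: pos_le_divide_eq)
    then have "(c * (r / \<sigma>) powr \<alpha> * M \<sigma>) ^ Suc n \<le> t ^ Suc n"
      using ac M\<sigma> by (intro power_mono) auto
    then have "c ^ Suc n * ((r / \<sigma>) powr \<alpha>) ^ Suc n * M \<sigma> ^ Suc n \<le> t ^ Suc n"
      by (simp only: power_mult_distrib)
    moreover have "r / \<sigma> \<le> ((r / \<sigma>) powr \<alpha>) ^ Suc n"
    proof -
      have "(r / \<sigma>) powr 1 \<le> (r / \<sigma>) powr (\<alpha> * Suc n)" by (rule powr_mono[OF n r(1)])
      also have "\<dots> = ((r / \<sigma>) powr \<alpha>) ^ Suc n"
        using r * by (simp only: powr_powr[symmetric]) (subst powr_realpow, auto)
      finally show ?thesis using r * by simp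
    qed
    then have "c ^ Suc n * (r / \<sigma>) * M \<sigma> ^ Suc n \<le> c ^ Suc n * ((r / \<sigma>) powr \<alpha>) ^ Suc n * M \<sigma> ^ Suc n"
      using ac M\<sigma> by (intro mult_right_mono mult_left_mono) auto
    ultimately have "c ^ Suc n * (r / \<sigma>) * M \<sigma> ^ Suc n \<le> t ^ Suc n" by linarith
    moreover have "0 < c ^ Suc n" using ac by simp
    ultimately have "1 / \<sigma> * M \<sigma> ^ Suc n \<le> 1 / c ^ Suc n * t ^ Suc n / r"
      using r(2) *(1) ac(2) by (simp add: pos_le_divide_eq mult_ac)
    also have "\<dots> \<le> C * t ^ Suc n / r"
      unfolding C_def using * M0 by (intro divide_right_mono mult_right_mono) auto
    finally show ?thesis .
  next
    case False
    have "M \<sigma> \<le> M s0" using False * ac by (intro mono_onD[OF M(1)]) auto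
    then have "1 / \<sigma> * M \<sigma> ^ Suc n \<le> 1 * M s0 ^ Suc n"
      using * M by (intro mult_mono power_mono) (auto intro: less_imp_le)
    also have "\<dots> \<le> M s0 ^ Suc n * (t ^ Suc n / r)"
    proof -
      have "t ^ 1 \<le> t ^ Suc n" using * by (intro power_increasing) auto
      then have "r \<le> t ^ Suc n" using *(3) by (simp only: power_one_right)
      then have "1 \<le> t ^ Suc n / r" using *(1,2) by (simp only: pos_le_divide_eq)
      then show ?thesis using M0 by (metis mult.commute mult_left_mono less_imp_le zero_less_power)
    qed
    also have "\<dots> \<le> C * (t ^ Suc n / r)"
      unfolding C_def using * ac by (intro mult_right_mono) auto
    finally show ?thesis by simp
  qed
  moreover have "0 \<le> C" using ac M0 by (simp add: C_def)
  ultimately show ?thesis using that by blast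
qed

text \<open>
  By continuity the supremum that defines the right inverse is a maximum; the lower bound on \<open>M\<close>
  keeps the set bounded.
\<close>

lemma right_inverse_attained:
  fixes M :: "real \<Rightarrow> real"
  assumes cont: "continuous_on {a..} M" and lower: "\<And>s. a \<le> s \<Longrightarrow> s \<le> M s" and t: "M a \<le> t"
  shows "a \<le> right_inverse a M t" "M (right_inverse a M t) \<le> t"
proof -
  let ?S = "{r. a \<le> r \<and> M r \<le> t}"
  have "closed ({a..} \<inter> M -` {..t})"
    by (rule continuous_closed_preimage[OF cont]) auto
  moreover have "{a..} \<inter> M -` {..t} = ?S" by auto
  ultimately have "closed ?S" by simp
  moreover have "?S \<noteq> {}" using t by auto
  moreover have "bdd_above ?S"
    by (rule bdd_aboveI[of _ t]) (use lower in force)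
  ultimately have "Sup ?S \<in> ?S" by (intro closed_contains_Sup)
  then show "a \<le> right_inverse a M t" "M (right_inverse a M t) \<le> t"
    by (auto simp: right_inverse_def)
qed

section \<open>The decay rate\<close>

theorem theorem3p6:
  fixes T :: "real \<Rightarrow> 'a \<Rightarrow> 'a::complex_hilbert_space"
    and D :: "'a set" and A :: "'a \<Rightarrow> 'a" and M :: "real \<Rightarrow> real"
  assumes "bounded_C0_semigroup T"
    and "is_generator D A T"
    and "spectrum D A \<inter> range (\<lambda>s::real. \<i> * of_real s) = {0}"
    and "bdd_above ((\<lambda>s::real. onorm (resolvent D A (\<i> * of_real s))) ` {s. 1 \<le> \<bar>s\<bar>})"
    and "continuous_on {1..} M"
    and "mono_on {1..} M"
    and "\<forall>s\<ge>1. 0 < M s"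
    and "positive_increase 1 M"
    and "\<forall>s::real. 1 \<le> \<bar>s\<bar> \<longrightarrow> onorm (resolvent D A (\<i> * of_real (inverse s))) \<le> M \<bar>s\<bar>"
  shows "(\<lambda>t. onorm (\<lambda>x. T t (A (resolvent D A 1 x))))
           \<in> O[at_top](\<lambda>t. 1 / right_inverse 1 M t)"
proof -
  obtain K0 where K0: "\<And>t. 0 \<le> t \<Longrightarrow> onorm (T t) \<le> K0"
    using assms(1) by (auto simp: bounded_C0_semigroup_def bdd_above_def)
  define K where "K = max 1 K0"
  interpret bounded_semigroup_generator T D A K
  proof
    show sg: "C0_semigroup T" using assms(1) by (simp add: bounded_C0_semigroup_def)
    show "norm (T t x) \<le> K * norm x" if "0 \<le> t" for t x
    proof -
      have "norm (T t x) \<le> onorm (T t) * norm x"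
        using sg that by (intro onorm bounded_clinearD) (simp add: C0_semigroup_def)
      also have "\<dots> \<le> K * norm x" using K0[OF that] by (intro mult_right_mono) (auto simp: K_def)
      finally show ?thesis .
    qed
  qed (use assms(2) in \<open>auto simp: K_def\<close>)
  have axis: "\<i> * of_real \<omega> \<notin> spectrum D A" if "\<omega> \<noteq> 0" for \<omega>
  proof
    assume "\<i> * of_real \<omega> \<in> spectrum D A"
    then have "\<i> * of_real \<omega> \<in> spectrum D A \<inter> range (\<lambda>s::real. \<i> * of_real s)" by blast
    with assms(3) that show False by simp
  qed
  have bound: "norm (resolvent D A (\<i> * of_real \<omega>) x) \<le> onorm (resolvent D A (\<i> * of_real \<omega>)) * norm x"
    and onorm_nonneg: "0 \<le> onorm (resolvent D A (\<i> * of_real \<omega>))" if "\<omega> \<noteq> 0" for \<omega> x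
    using bounded_clinearD(1)[OF bounded_clinear_resolvent[OF axis[OF that]]]
    by (simp_all add: onorm onorm_pos_le)
  obtain L where L: "\<And>\<omega>. 1 \<le> \<bar>\<omega>\<bar> \<Longrightarrow> onorm (resolvent D A (\<i> * of_real \<omega>)) \<le> L"
    using assms(4) by (auto simp: bdd_above_def)
  have L0: "0 \<le> L" using L[of 1] onorm_nonneg[of 1] by simp
  have high: "norm (resolvent D A (\<i> * of_real \<omega>) x) \<le> L * norm x" if "1 \<le> \<bar>\<omega>\<bar>" for \<omega> x
    using that L[OF that] by (intro order_trans[OF bound mult_right_mono]) auto
  have near_zero: "norm (resolvent D A (\<i> * of_real \<omega>) x) \<le> M (1 / \<bar>\<omega>\<bar>) * norm x"
    if "\<omega> \<noteq> 0" "\<bar>\<omega>\<bar> \<le> 1" for \<omega> x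
  proof -
    have "1 \<le> \<bar>1 / \<omega>\<bar>" using that by simp
    then have "onorm (resolvent D A (\<i> * of_real (inverse (1 / \<omega>)))) \<le> M \<bar>1 / \<omega>\<bar>"
      using assms(9) by blast
    then show ?thesis
      using that by (intro order_trans[OF bound mult_right_mono]) auto
  qed
  \<comment> \<open>A resolvent at distance \<open>1/s\<close> from the spectral point \<open>0\<close> has norm at least \<open>s\<close>.\<close>
  have M_ge: "s \<le> M s" if s: "1 \<le> s" for s
  proof (rule ccontr)
    assume "\<not> s \<le> M s"
    then have small: "cmod (\<i> * of_real (1 / s) - 0) * M s < 1" using s by (simp add: norm_divide)
    have "norm (resolvent D A (\<i> * of_real (1 / s)) x) \<le> M s * norm x" for x
      using near_zero[of "1 / s" x] s by simp
    from resolvent_set_perturbation[OF axis this small] s have "0 \<notin> spectrum D A" by simp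
    with assms(3) show False by blast
  qed
  obtain C :: real and n where C: "0 \<le> C" and weight: "\<And>\<sigma> r t. 1 \<le> \<sigma> \<Longrightarrow> \<sigma> \<le> r \<Longrightarrow> r \<le> t \<Longrightarrow> M r \<le> t \<Longrightarrow>
    1 / \<sigma> * M \<sigma> ^ Suc n \<le> C * t ^ Suc n / r"
    by (rule positive_increase_absorbs_weight[OF assms(6-8)]) (rule that; blast)
  obtain G where G: "0 \<le> G" and R1: "\<And>x. resolvent D A 1 x \<in> D"
    "\<And>x. resolvent D A 1 x - A (resolvent D A 1 x) = x"
    "\<And>x. norm (resolvent D A 1 x) \<le> G * norm x"
    by (rule resolvent_at_one[OF axis[OF one_neq_zero]]) (rule that; blast)
  obtain H where H: "0 \<le> H" and orbit_decay:
    "\<And>q g r t N. q \<in> D \<Longrightarrow> norm q \<le> g \<Longrightarrow> norm (A q) \<le> g \<Longrightarrow> 1 \<le> r \<Longrightarrow> r \<le> t \<Longrightarrow>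
      (\<And>\<omega> x. 1 / r < \<bar>\<omega>\<bar> \<Longrightarrow> \<bar>\<omega>\<bar> \<le> 1 \<Longrightarrow> norm (resolvent D A (\<i> * of_real \<omega>) x) \<le> N \<omega> * norm x) \<Longrightarrow>
      (\<And>\<omega>. 1 / r < \<bar>\<omega>\<bar> \<Longrightarrow> \<bar>\<omega>\<bar> \<le> 1 \<Longrightarrow>
        0 \<le> N \<omega> \<and> N \<omega> \<le> t \<and> \<bar>\<omega>\<bar> * N \<omega> ^ Suc n \<le> C * t ^ Suc n / r) \<Longrightarrow>
      norm (T t (A q)) \<le> H / r * g"
    by (rule generator_orbit_decay[OF axis high L0 C, where n = n]) (assumption | rule that; blast)+
  define H' where "H' = H * (1 + G)"
  have H': "0 \<le> H'" using H G by (simp add: H'_def)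
  have decay: "norm (T t (A (resolvent D A 1 x))) \<le> H' / right_inverse 1 M t * norm x"
    if t: "max 1 (M 1) \<le> t" for t x
  proof -
    define r where "r = right_inverse 1 M t"
    have r: "1 \<le> r" "M r \<le> t"
      unfolding r_def using right_inverse_attained[OF assms(5) M_ge] t by auto
    have rt: "r \<le> t" using M_ge[OF r(1)] r(2) by simp
    define q where "q = resolvent D A 1 x"
    have q: "q \<in> D" and Aq: "A q = q - x" using R1(1)[of x] R1(2)[of x] by (auto simp: q_def algebra_simps)
    have "norm q \<le> G * norm x" unfolding q_def by (rule R1)
    moreover have "norm (A q) \<le> norm q + norm x" unfolding Aq by (rule norm_triangle_ineq4)
    ultimately have nq: "norm q \<le> (1 + G) * norm x" "norm (A q) \<le> (1 + G) * norm x"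
      using norm_ge_zero[of x] unfolding distrib_right mult_1_left by linarith+
    have "norm (T t (A q)) \<le> H / r * ((1 + G) * norm x)"
    proof (rule orbit_decay[OF q nq r(1) rt, where N = "\<lambda>\<omega>. M (1 / \<bar>\<omega>\<bar>)"])
      fix \<omega> :: real assume \<omega>: "1 / r < \<bar>\<omega>\<bar>" "\<bar>\<omega>\<bar> \<le> 1"
      have "0 < 1 / r" using r by simp
      then have pos: "0 < \<bar>\<omega>\<bar>" using \<omega> by linarith
      then show "norm (resolvent D A (\<i> * of_real \<omega>) x) \<le> M (1 / \<bar>\<omega>\<bar>) * norm x" for x
        using \<omega> by (intro near_zero) auto
      have \<sigma>: "1 \<le> 1 / \<bar>\<omega>\<bar>" "1 / \<bar>\<omega>\<bar> \<le> r" using pos \<omega> r by (auto simp: field_simps)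
      have "M (1 / \<bar>\<omega>\<bar>) \<le> M r" using \<sigma> r by (intro mono_onD[OF assms(6)]) auto
      moreover have "0 < M (1 / \<bar>\<omega>\<bar>)" using \<sigma> assms(7) by blast
      ultimately show "0 \<le> M (1 / \<bar>\<omega>\<bar>) \<and> M (1 / \<bar>\<omega>\<bar>) \<le> t \<and>
          \<bar>\<omega>\<bar> * M (1 / \<bar>\<omega>\<bar>) ^ Suc n \<le> C * t ^ Suc n / r"
        using weight[OF \<sigma> rt r(2)] r(2) by simp
    qed
    then show ?thesis by (simp add: q_def r_def H'_def)
  qed
  have "\<forall>\<^sub>F t in at_top. norm (onorm (\<lambda>x. T t (A (resolvent D A 1 x))))
      \<le> H' * norm (1 / right_inverse 1 M t)"
    using eventually_ge_at_top[of "max 1 (M 1)"]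
  proof eventually_elim
    fix t assume t: "max 1 (M 1) \<le> t"
    let ?f = "\<lambda>x. T t (A (resolvent D A 1 x))" and ?r = "right_inverse 1 M t"
    have r: "1 \<le> ?r" using right_inverse_attained(1)[OF assms(5) M_ge] t by auto
    have H: "0 \<le> H' / ?r" using H' r by simp
    have "onorm ?f \<le> H' / ?r" by (rule onorm_bound[OF H decay[OF t]])
    \<comment> \<open>The supremum that defines \<open>onorm\<close> is bounded, and it is at least the value \<open>0/0 = 0\<close> at \<open>x = 0\<close>.\<close>
    moreover have "0 \<le> onorm ?f"
    proof -
      have "norm (?f x) / norm x \<le> H' / ?r" for x
        using decay[OF t, of x] H by (cases "x = 0") (simp_all add: divide_le_eq)
      then have "bdd_above (range (\<lambda>x. norm (?f x) / norm x))"
        by (intro bdd_aboveI) auto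
      from cSUP_upper[OF UNIV_I this, of 0] show ?thesis by (simp add: onorm_def)
    qed
    ultimately show "norm (onorm ?f) \<le> H' * norm (1 / ?r)" using r by simp
  qed
  then show ?thesis by (rule bigoI)
qed

end
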